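(* Let $(X,\varphi)$ be a Cantor minimal system. The commutator subgroup $D([[\varphi]]_0)$ of $[[\varphi]]_0$ is simple.
   Context: A Cantor minimal system $(X,\varphi)$ is a Cantor set $X$ (compact, metrizable, perfect, totally disconnected, nonempty) with a homeomorphism $\varphi$ of $X$ that is minimal: the only closed $\varphi$-invariant subsets are $\emptyset$ and $X$. The topological full group $[[\varphi]]$ is the group of all homeomorphisms $\gamma$ of $X$ for which there is a continuous map $n_\gamma:X\to\mathbb{Z}$ with $\gamma(x)=\varphi^{n_\gamma(x)}(x)$ for all $x\in X$. The index map $I:[[\varphi]]\to\mathbb{Z}$ is $I(\gamma)=\int n_\gamma\,d\mu$, where $\mu$ is a $\varphi$-invariant probability measure; it is known that $I(\gamma)$ is an integer independent of $\mu$ and that $I$ is a surjective homomorphism. $[[\varphi]]_0$ is the kernel of $I$. For a group $H$, $D(H)$ is its commutator subgroup. *)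

theory Defs
  imports "HOL-Probability.Probability" "HOL-Algebra.Bij" "HOL-Algebra.Generated_Groups"
begin

definition cantor_set :: "'a topology \<Rightarrow> bool" where
  "cantor_set T \<longleftrightarrow>
     topspace T \<noteq> {} \<and> compact_space T \<and> metrizable_space T \<and>
     T derived_set_of (topspace T) = topspace T \<and>
     (\<forall>S. connectedin T S \<longrightarrow> (\<exists>a. S \<subseteq> {a}))"

definition cantor_minimal_system :: "'a topology \<Rightarrow> ('a \<Rightarrow> 'a) \<Rightarrow> bool" where
  "cantor_minimal_system T \<phi> \<longleftrightarrow>
     cantor_set T \<and> homeomorphic_map T T \<phi> \<and>
     (\<forall>C. closedin T C \<and> \<phi> ` C = C \<longrightarrow> C = {} \<or> C = topspace T)"

definition int_iterate :: "'a set \<Rightarrow> ('a \<Rightarrow> 'a) \<Rightarrow> int \<Rightarrow> 'a \<Rightarrow> 'a" where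
  "int_iterate X \<phi> k =
     (if k \<ge> 0 then \<phi> ^^ nat k else inv_into X \<phi> ^^ nat (- k))"

definition orbit_cocycle :: "'a topology \<Rightarrow> ('a \<Rightarrow> 'a) \<Rightarrow> ('a \<Rightarrow> 'a) \<Rightarrow> ('a \<Rightarrow> int) \<Rightarrow> bool" where
  "orbit_cocycle T \<phi> \<gamma> n \<longleftrightarrow>
     continuous_map T (discrete_topology UNIV) n \<and>
     (\<forall>x\<in>topspace T. \<gamma> x = int_iterate (topspace T) \<phi> (n x) x)"

text \<open>As in \<^const>\<open>BijGroup\<close>, homeomorphisms are represented by functions that are undefined
  outside \<^term>\<open>topspace T\<close>, so that equality of group elements is equality on the space.\<close>

definition topological_full_group :: "'a topology \<Rightarrow> ('a \<Rightarrow> 'a) \<Rightarrow> ('a \<Rightarrow> 'a) monoid" where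
  "topological_full_group T \<phi> = (BijGroup (topspace T))
     \<lparr>carrier := {\<gamma> \<in> Bij (topspace T). homeomorphic_map T T \<gamma> \<and> (\<exists>n. orbit_cocycle T \<phi> \<gamma> n)}\<rparr>"

definition invariant_prob_measure :: "'a topology \<Rightarrow> ('a \<Rightarrow> 'a) \<Rightarrow> 'a measure \<Rightarrow> bool" where
  "invariant_prob_measure T \<phi> \<mu> \<longleftrightarrow>
     prob_space \<mu> \<and>
     sets \<mu> = sets (sigma (topspace T) {U. openin T U}) \<and>
     distr \<mu> \<mu> \<phi> = \<mu>"

text \<open>For a Cantor minimal system both choices below are harmless: every \<open>\<phi>\<close>-orbit is infinite, so
  the cocycle is unique on \<^term>\<open>topspace T\<close>; an invariant probability measure exists, and the
  integral is an integer that does not depend on which one is chosen.\<close>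

definition index_map :: "'a topology \<Rightarrow> ('a \<Rightarrow> 'a) \<Rightarrow> ('a \<Rightarrow> 'a) \<Rightarrow> real" where
  "index_map T \<phi> \<gamma> =
     (let n = (SOME n. orbit_cocycle T \<phi> \<gamma> n);
          \<mu> = (SOME \<mu>. invariant_prob_measure T \<phi> \<mu>)
      in integral\<^sup>L \<mu> (\<lambda>x. real_of_int (n x)))"

definition index_kernel_group :: "'a topology \<Rightarrow> ('a \<Rightarrow> 'a) \<Rightarrow> ('a \<Rightarrow> 'a) monoid" where
  "index_kernel_group T \<phi> = (topological_full_group T \<phi>)
     \<lparr>carrier := {\<gamma> \<in> carrier (topological_full_group T \<phi>). index_map T \<phi> \<gamma> = 0}\<rparr>"

definition commutator_group :: "('g, 'm) monoid_scheme \<Rightarrow> ('g, 'm) monoid_scheme" where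
  "commutator_group G = G\<lparr>carrier := derived G (carrier G)\<rparr>"

text \<open>The locale \<open>simple_group\<close> of HOL-Algebra expresses non-triviality as \<open>order G > 1\<close>. Since
  \<^const>\<open>order\<close> is \<open>0\<close> on infinite groups, no infinite group satisfies it.\<close>

definition is_simple_group :: "('g, 'm) monoid_scheme \<Rightarrow> bool" where
  "is_simple_group G \<longleftrightarrow>
     group G \<and> carrier G \<noteq> {\<one>\<^bsub>G\<^esub>} \<and>
     (\<forall>N. N \<lhd> G \<longrightarrow> N = {\<one>\<^bsub>G\<^esub>} \<or> N = carrier G)"

end

(* For a clopen set U with disjoint translates ("levels") phi^i(U), i in F, every permutation of F
   gives an element of [[phi]]; it is a swap or a 3-cycle if the permutation is one. Let Alt be the
   group generated by the 3-cycles. Cutting U into small pieces shows that Alt is normal in [[phi]] and that swaps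
   are central modulo Alt, because the commutator of a swap of small support with any g is a product
   of two transpositions of levels. Every g in [[phi]] is a product of swaps and a power of phi:
   near a small clopen set C one can correct g by finitely many swaps and a power of phi so that no
   orbit point crosses C, and the result permutes the levels of the Kakutani-Rohlin towers over C.
   So [[phi]]/Alt is abelian. Since a 3-cycle is a commutator of two 3-cycles on five levels and the
   index of a 3-cycle is zero, D([[phi]]_0) = Alt.

   Given g <> 1 in a normal subgroup N of Alt, choose an open V with g(V) disjoint from V. For
   3-cycles a, b supported in V one has [a, b] = [[a, g], b] in N, so N contains 3-cycles supported
   in V. By minimality every orbit visits V infinitely often, so all sufficiently small 3-cycles are
   conjugate to these, and they generate Alt. *)

theory Submission
  imports Defs "HOL-Combinatorics.Permutations"
begin

subsection \<open>Clopen sets and integer iterates\<close>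

text \<open>The obstacle is that an element of the full group has no uniform description on large
  sets: its cocycle is constant only on small clopen sets. The remedy is that \<open>lev U p\<close>
  is multiplicative in \<open>U\<close> over disjoint unions. By compactness, membership of
  \<open>lev U p\<close> in a set closed under products then has to be checked only for
  \<open>U\<close> near a point \<open>x\<close>. Since the orbit of \<open>x\<close> is infinite,
  any finite set of integers names disjoint levels over a small \<open>U\<close>, and an element of
  the full group moves these levels by an injection of the integers. What remains is computation
  with permutations of finitely many integers; infinite orbits also supply the spare levels that the
  3-cycle identities consume.

  The index is defined through a chosen invariant measure, so the existence of one must be proved
  before anything can be said about it. What is then used is additivity: an element with trivial
  cube has index zero. The commutator subgroup equals the alternating part for every subgroup that
  contains the 3-cycles, and the kernel of the index is one of these.\<close>

lemma zero_dimensional_compact: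
  assumes "compact_space T" "Hausdorff_space T" "\<And>S. connectedin T S \<Longrightarrow> \<exists>a. S \<subseteq> {a}"
    and "openin T U" "x \<in> U"
  shows "\<exists>V. openin T V \<and> closedin T V \<and> x \<in> V \<and> V \<subseteq> U"
proof -
  have xX: "x \<in> topspace T" using openin_subset[OF assms(4)] assms(5) by auto
  have "connected_component_of_set T x = {x}"
  proof -
    obtain a where "connected_component_of_set T x \<subseteq> {a}"
      using assms(3)[OF connectedin_connected_component_of[of T x]] by blast
    moreover have "x \<in> connected_component_of_set T x" using xX by (simp add: connected_component_of_refl)
    ultimately show ?thesis by auto
  qed
  \<comment> \<open>In a compact Hausdorff space components are quasi-components, and a
    quasi-component can be separated from a disjoint compact set by a clopen partition.\<close>
  then have q: "quasi_component_of_set T x = {x}"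
    using quasi_eq_connected_component_of[of T x] assms(1,2) by simp
  then have "{x} \<in> quasi_components_of T"
    using xX by (metis image_eqI quasi_components_of_def)
  moreover have "compactin T (topspace T - U)"
    using assms(1,4) by (intro closedin_compact_space) auto
  ultimately have "separated_between T (topspace T - U) {x}"
    using separated_between_compact_quasi_component[of T "topspace T - U" "{x}"] assms(5)
    by (auto simp: disjnt_def)
  then obtain A B where AB: "openin T A" "openin T B" "A \<union> B = topspace T" "disjnt A B"
      "topspace T - U \<subseteq> A" "{x} \<subseteq> B"
    by (auto simp: separated_between_def)
  have "B = topspace T - A" using AB by (auto simp: disjnt_def)
  then have "closedin T B" using AB by auto
  then show ?thesis using AB by (intro exI[of _ B]) (auto simp: disjnt_def)
qed

lemma inv_into_funpow_commute:
  assumes "bij_betw f X X" "x \<in> X"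
  shows "(inv_into X f ^^ n) x \<in> X" "(f ^^ n) x \<in> X"
  by (induction n) (use assms bij_betw_inv_into[OF assms(1)] in \<open>auto dest: bij_betw_apply\<close>)

lemma int_iterate_step:
  assumes b: "bij_betw f X X" and x: "x \<in> X"
  shows "int_iterate X f (k + 1) x = f (int_iterate X f k x)"
    and "int_iterate X f (k - 1) x = inv_into X f (int_iterate X f k x)"
proof -
  have fi: "f (inv_into X f y) = y" if "y \<in> X" for y
    using b that by (simp add: bij_betw_inv_into_right)
  have if1: "inv_into X f (f y) = y" if "y \<in> X" for y
    using b that by (simp add: bij_betw_inv_into_left)
  show "int_iterate X f (k + 1) x = f (int_iterate X f k x)"
  proof (cases "k \<ge> 0")
    case True
    then have "nat (k + 1) = Suc (nat k)" by auto
    then show ?thesis using True by (simp add: int_iterate_def)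
  next
    case False
    then obtain m where m: "nat (- k) = Suc m" "nat (- (k + 1)) = m" by (cases "nat (-k)") auto
    have "k + 1 \<ge> 0 \<Longrightarrow> m = 0" using m by linarith
    then show ?thesis using False m fi inv_into_funpow_commute[OF b x]
      by (cases "k + 1 \<ge> 0") (auto simp: int_iterate_def x)
  qed
  show "int_iterate X f (k - 1) x = inv_into X f (int_iterate X f k x)"
  proof (cases "k > 0")
    case True
    then obtain m where m: "nat k = Suc m" "nat (k - 1) = m" by (cases "nat k") auto
    then show ?thesis using True if1 inv_into_funpow_commute[OF b x]
      by (auto simp: int_iterate_def)
  next
    case False
    then have "nat (- (k - 1)) = Suc (nat (- k))" by auto
    then show ?thesis using False by (cases "k = 0") (auto simp: int_iterate_def)
  qed
qed

lemma int_iterate_in: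
  assumes "bij_betw f X X" "x \<in> X"
  shows "int_iterate X f k x \<in> X"
  using inv_into_funpow_commute[OF assms] by (simp add: int_iterate_def)

lemma int_iterate_add:
  assumes b: "bij_betw f X X" and x: "x \<in> X"
  shows "int_iterate X f (k + l) x = int_iterate X f k (int_iterate X f l x)"
proof (induction k rule: int_induct[where k = 0])
  case base
  then show ?case by (simp add: int_iterate_def)
next
  case (step1 i)
  then show ?case using int_iterate_step(1)[OF b, of _ "i + l"] int_iterate_step(1)[OF b, of _ i] x
      int_iterate_in[OF b x] by (simp add: algebra_simps)
next
  case (step2 i)
  then show ?case using int_iterate_step(2)[OF b, of _ "i + l"] int_iterate_step(2)[OF b, of _ i] x
      int_iterate_in[OF b x] by (simp add: algebra_simps)
qed

locale cantor_minimal =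
  fixes T :: "'a topology" and \<phi> :: "'a \<Rightarrow> 'a"
  assumes cms: "cantor_minimal_system T \<phi>"
begin

abbreviation X where "X \<equiv> topspace T"

definition clopen where "clopen U \<longleftrightarrow> openin T U \<and> closedin T U"

definition act :: "int \<Rightarrow> 'a \<Rightarrow> 'a" where "act = int_iterate X \<phi>"

lemma X_ne: "X \<noteq> {}" and compact: "compact_space T" and metrizable: "metrizable_space T"
  and totally_disconnected: "\<And>S. connectedin T S \<Longrightarrow> \<exists>a. S \<subseteq> {a}"
  and perfect: "T derived_set_of X = X"
  and homeo: "homeomorphic_map T T \<phi>"
  and minimal: "\<And>C. closedin T C \<Longrightarrow> \<phi> ` C = C \<Longrightarrow> C = {} \<or> C = X"
  using cms by (auto simp: cantor_minimal_system_def cantor_set_def)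

lemma Hausdorff: "Hausdorff_space T"
  using metrizable by (simp add: metrizable_imp_Hausdorff_space)

lemma clopen_subset: "clopen U \<Longrightarrow> U \<subseteq> X"
  by (simp add: clopen_def openin_subset)

lemma clopenD: "clopen U \<Longrightarrow> openin T U" "clopen U \<Longrightarrow> closedin T U"
  by (auto simp: clopen_def)

lemma clopen_basis: "openin T U \<Longrightarrow> x \<in> U \<Longrightarrow> \<exists>V. clopen V \<and> x \<in> V \<and> V \<subseteq> U"
  using zero_dimensional_compact[OF compact Hausdorff totally_disconnected] by (simp add: clopen_def conj_assoc)

lemma clopen_empty [simp]: "clopen {}" and clopen_X [simp]: "clopen X"
  by (auto simp: clopen_def)

lemma clopen_Un: "clopen U \<Longrightarrow> clopen V \<Longrightarrow> clopen (U \<union> V)"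
  and clopen_Int: "clopen U \<Longrightarrow> clopen V \<Longrightarrow> clopen (U \<inter> V)"
  and clopen_Diff: "clopen U \<Longrightarrow> clopen V \<Longrightarrow> clopen (U - V)"
  by (auto simp: clopen_def openin_diff closedin_diff)

lemma clopen_INT:
  "finite I \<Longrightarrow> I \<noteq> {} \<Longrightarrow> (\<And>i. i \<in> I \<Longrightarrow> clopen (f i)) \<Longrightarrow> clopen (\<Inter>i\<in>I. f i)"
  by (induction rule: finite_ne_induct) (auto simp: clopen_Int)

lemma clopen_UN:
  "finite I \<Longrightarrow> (\<And>i. i \<in> I \<Longrightarrow> clopen (f i)) \<Longrightarrow> clopen (\<Union>i\<in>I. f i)"
  by (induction rule: finite_induct) (auto simp: clopen_Un)

lemma compact_cover:
  assumes "\<And>i. i \<in> I \<Longrightarrow> openin T (W i)" "X \<subseteq> (\<Union>i\<in>I. W i)"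
  obtains J where "finite J" "J \<subseteq> I" "X \<subseteq> (\<Union>i\<in>J. W i)"
proof -
  have "\<forall>U\<in>W ` I. openin T U" "X \<subseteq> \<Union>(W ` I)" using assms by auto
  then obtain F where F: "finite F" "F \<subseteq> W ` I" "X \<subseteq> \<Union>F"
    using compact unfolding compact_space_alt by meson
  then obtain J where "J \<subseteq> I" "finite J" "F = W ` J"
    by (meson finite_subset_image)
  then show ?thesis using that F by auto
qed

text \<open>Finitely many of the sets \<open>W\<close> cover \<open>X\<close>, and cutting a clopen
  set along them makes the pieces disjoint. The local hypothesis covers all clopen subsets of
  \<open>W\<close> because the pieces are such subsets.\<close>

lemma clopen_induct [consumes 1, case_names empty union local]:
  assumes U: "clopen U"
    and empty: "P {}"
    and un: "\<And>U V. clopen U \<Longrightarrow> clopen V \<Longrightarrow> U \<inter> V = {} \<Longrightarrow> P U \<Longrightarrow> P V \<Longrightarrow> P (U \<union> V)"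
    and loc: "\<And>x. x \<in> X \<Longrightarrow> \<exists>W. clopen W \<and> x \<in> W \<and> (\<forall>U. clopen U \<longrightarrow> U \<subseteq> W \<longrightarrow> P U)"
  shows "P U"
proof -
  obtain W where W: "\<And>x. x \<in> X \<Longrightarrow> clopen (W x) \<and> x \<in> W x \<and> (\<forall>U. clopen U \<longrightarrow> U \<subseteq> W x \<longrightarrow> P U)"
    using loc by metis
  obtain J where J: "finite J" "J \<subseteq> X" "X \<subseteq> (\<Union>x\<in>J. W x)"
    by (rule compact_cover[of X W]) (use W clopenD in auto)
  have "clopen U \<longrightarrow> U \<subseteq> (\<Union>x\<in>J. W x) \<longrightarrow> P U" for U
    using J(1) J(2)
  proof (induction J arbitrary: U rule: finite_induct)
    case empty
    then show ?case using assms(2) by auto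
  next
    case (insert x F)
    show ?case
    proof (intro impI)
      assume U: "clopen U" "U \<subseteq> (\<Union>x\<in>insert x F. W x)"
      have wx: "clopen (W x)" using W insert.prems by auto
      have "P (U \<inter> W x)" using W[of x] insert.prems U by (auto intro: clopen_Int)
      moreover have "P (U - W x)" using insert U wx by (auto intro: clopen_Diff)
      ultimately have "P ((U \<inter> W x) \<union> (U - W x))"
        by (intro un) (use U wx in \<open>auto intro: clopen_Diff clopen_Int\<close>)
      then show "P U" by (simp add: Int_Diff_Un)
    qed
  qed
  then show ?thesis using U J clopen_subset[OF U] by blast
qed

section \<open>The action of the integers generated by \<open>\<phi>\<close>\<close>

lemma bij: "bij_betw \<phi> X X"
  using homeo
    by (simp add: bij_betw_def homeomorphic_imp_injective_map homeomorphic_imp_surjective_map)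

lemma act_in [simp]: "x \<in> X \<Longrightarrow> act k x \<in> X"
  using int_iterate_in[OF bij] by (simp add: act_def)

lemma act_0 [simp]: "act 0 x = x" by (simp add: act_def int_iterate_def)

lemma act_1: "act 1 x = \<phi> x" by (simp add: act_def int_iterate_def)

lemma act_act [simp]: "x \<in> X \<Longrightarrow> act k (act l x) = act (k + l) x"
  using int_iterate_add[OF bij] by (simp add: act_def)

lemma act_continuous: "continuous_map T T (act k)"
proof -
  have invc: "continuous_map T T (inv_into X \<phi>)"
  proof -
    obtain g where g: "continuous_map T T g" "\<And>x. x \<in> X \<Longrightarrow> \<phi> (g x) = x"
      using homeo unfolding homeomorphic_map_maps homeomorphic_maps_def by blast
    have "inv_into X \<phi> x = g x" if x: "x \<in> X" for x
    proof -
      have "g x \<in> X" using g(1) x by (simp add: continuous_map_def Pi_iff)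
      then show ?thesis using g(2)[OF x] bij_betw_inv_into_left[OF bij] by metis
    qed
    then show ?thesis using continuous_map_eq[OF g(1)] by metis
  qed
  have 1: "continuous_map T T (f ^^ n)" if "continuous_map T T f" for f n
    by (induction n) (use that in \<open>auto intro: continuous_map_compose[unfolded o_def]\<close>)
  show ?thesis unfolding act_def int_iterate_def using 1[OF invc] 1[of \<phi>] homeo
    by (auto simp: homeomorphic_imp_continuous_map)
qed

lemma act_inj_point: "x \<in> X \<Longrightarrow> y \<in> X \<Longrightarrow> act k x = act k y \<Longrightarrow> x = y"
  by (drule arg_cong[where f = "act (- k)"]) simp

definition pre :: "int \<Rightarrow> 'a set \<Rightarrow> 'a set" where "pre k U = {x \<in> X. act k x \<in> U}"

lemma mem_pre [simp]: "x \<in> pre k U \<longleftrightarrow> x \<in> X \<and> act k x \<in> U" by (simp add: pre_def)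

lemma clopen_pre: "clopen U \<Longrightarrow> clopen (pre k U)"
  using act_continuous[of k] unfolding clopen_def pre_def
  by (auto intro: openin_continuous_map_preimage closedin_continuous_map_preimage)

lemma openin_pre: "openin T U \<Longrightarrow> openin T (pre k U)"
  using act_continuous[of k] unfolding pre_def
  by (auto intro: openin_continuous_map_preimage)

lemma image_act:
  assumes "U \<subseteq> X"
  shows "act k ` U = pre (- k) U"
proof
  show "pre (- k) U \<subseteq> act k ` U"
  proof
    fix y assume "y \<in> pre (- k) U"
    then have "act (- k) y \<in> U" "y = act k (act (- k) y)" by auto
    then show "y \<in> act k ` U" by blast
  qed
qed (use assms in auto)

lemma clopen_act: "clopen U \<Longrightarrow> clopen (act k ` U)"
  by (simp add: image_act clopen_subset clopen_pre)

text \<open>The points whose orbit avoids \<open>O'\<close> form a closed invariant set, and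
  minimality leaves only the empty set for it.\<close>

lemma orbit_meets:
  assumes O: "openin T O'" "O' \<noteq> {}" and x: "x \<in> X"
  shows "\<exists>k. act k x \<in> O'"
proof -
  define C where "C = X - (\<Union>k. pre k O')"
  have cl: "closedin T C" unfolding C_def using O openin_pre by (auto intro!: closedin_diff)
  have CX: "C \<subseteq> X" by (auto simp: C_def)
  have inv: "act k ` C \<subseteq> C" for k
    by (auto simp: C_def)
  have "C \<subseteq> act 1 ` C"
  proof
    fix y assume y: "y \<in> C"
    then have "act (-1) y \<in> C" using inv by blast
    moreover have "y = act 1 (act (-1) y)" using y CX by auto
    ultimately show "y \<in> act 1 ` C" by blast
  qed
  with inv have "act 1 ` C = C" by blast
  then have "\<phi> ` C = C" by (simp add: act_1)
  moreover have "C \<noteq> X"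
  proof -
    obtain y where "y \<in> O'" using O by auto
    then have "y \<in> pre 0 O'" "y \<in> X" using openin_subset[OF O(1)] by auto
    then show ?thesis unfolding C_def by blast
  qed
  ultimately have "C = {}" using minimal[OF cl] by auto
  then have "x \<in> (\<Union>k. pre k O')" using x unfolding C_def by blast
  then show ?thesis by auto
qed

lemma bounded_gaps:
  assumes O: "openin T O'" "O' \<noteq> {}"
  obtains H where "H \<ge> 0" "\<And>x. x \<in> X \<Longrightarrow> \<exists>k. 0 \<le> k \<and> k \<le> H \<and> act k x \<in> O'"
proof -
  obtain J where J: "finite J" "J \<subseteq> (UNIV :: int set)" "X \<subseteq> (\<Union>k\<in>J. pre k O')"
  proof (rule compact_cover[of UNIV "\<lambda>k. pre k O'"])
    show "X \<subseteq> (\<Union>k\<in>UNIV. pre k O')" using orbit_meets[OF O] by fastforce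
  qed (use O(1) openin_pre in auto)
  obtain B where B: "\<And>k. k \<in> J \<Longrightarrow> \<bar>k\<bar> \<le> B" "B \<ge> 0"
  proof
    show "k \<in> J \<Longrightarrow> \<bar>k\<bar> \<le> (\<Sum>k\<in>J. \<bar>k\<bar>)" for k
      using J(1) by (simp add: member_le_sum)
  qed (simp add: sum_nonneg)
  show ?thesis
  proof
    fix x assume x: "x \<in> X"
    \<comment> \<open>Compactness bounds the visiting times by \<open>B\<close> in absolute value.
      Starting from \<open>act B x\<close> instead of \<open>x\<close> shifts them into the range
      from 0 to \<open>2 * B\<close>.\<close>
    then obtain k where k: "k \<in> J" "act k (act B x) \<in> O'" using J(3) act_in[OF x, of B] by fastforce
    then show "\<exists>k. 0 \<le> k \<and> k \<le> 2 * B \<and> act k x \<in> O'"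
      using B(1)[of k] x by (intro exI[of _ "k + B"]) auto
  qed (use B in auto)
qed

text \<open>A periodic orbit is finite, hence closed, and it meets every nonempty open set. So it
  would be all of \<open>X\<close>, but a finite Hausdorff space has no limit points.\<close>

lemma finite_orbit_false:
  assumes x: "x \<in> X" and k: "act k x = x" "k > 0"
  shows False
proof -
  define C where "C = (\<lambda>i. act i x) ` {0..<k}"
  have per: "act (i + n * k) x = act i x" for i n
  proof (induction n rule: int_induct[where k = 0])
    case base then show ?case by simp
  next
    case (step1 n)
    have "act (i + (n + 1) * k) x = act (i + n * k) (act k x)"
      using x by (simp add: algebra_simps)
    then show ?case using k step1 by simp
  next
    case (step2 n)
    have "act (i + n * k) x = act (i + (n - 1) * k) (act k x)"
      using x by (simp add: algebra_simps)
    then show ?case using k step2 by simp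
  qed
  have allC: "act i x \<in> C" for i
  proof -
    have "act i x = act (i mod k) x" using per[of "i mod k" "i div k"]
      by (simp add: add.commute)
    then show ?thesis using k(2) by (auto simp: C_def)
  qed
  have finC: "finite C" by (simp add: C_def)
  have CX: "C \<subseteq> X" using x by (auto simp: C_def)
  have "X = C"
  proof (rule ccontr)
    assume "X \<noteq> C"
    then have "X - C \<noteq> {}" using CX by auto
    moreover have "openin T (X - C)" using finC CX Hausdorff
      by (meson closedin_Hausdorff_finite closedin_def)
    ultimately show False using orbit_meets[of "X - C" x] x allC by auto
  qed
  then have "T derived_set_of X = {}" 
    using finC Hausdorff_imp_t1_space[OF Hausdorff] t1_space_derived_set_of_finite[of T] by auto
  then show False using perfect X_ne by auto
qed

lemma act_free: "x \<in> X \<Longrightarrow> act k x = act l x \<longleftrightarrow> k = l"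
proof
  assume x: "x \<in> X" and e: "act k x = act l x"
  show "k = l"
  proof (rule ccontr)
    assume n: "k \<noteq> l"
    have 1: "act (k - l) x = x" "act (l - k) x = x"
      using arg_cong[OF e, of "act (- l)"] arg_cong[OF e, of "act (- k)"] x by simp_all
    show False using finite_orbit_false[OF x 1(1)] finite_orbit_false[OF x 1(2)] n by linarith
  qed
qed auto


subsection \<open>Elements of the topological full group\<close>

abbreviation G where "G \<equiv> topological_full_group T \<phi>"

text \<open>Replaces the existence of a continuous cocycle by a local condition, so that closure
  under composition and inverse is checked near one point at a time.\<close>

definition loc :: "('a \<Rightarrow> 'a) \<Rightarrow> bool" where
  "loc g \<longleftrightarrow> (\<forall>x\<in>X. \<exists>W k. openin T W \<and> x \<in> W \<and> (\<forall>y\<in>W. g y = act k y))"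

text \<open>The \<open>THE\<close> is well defined on \<open>X\<close> for \<open>loc g\<close>
  because the action is free.\<close>

definition cyc :: "('a \<Rightarrow> 'a) \<Rightarrow> 'a \<Rightarrow> int" where "cyc g x = (THE k. g x = act k x)"

lemma cyc_eqI: "x \<in> X \<Longrightarrow> g x = act k x \<Longrightarrow> cyc g x = k"
  unfolding cyc_def using act_free by (intro the_equality) auto

lemma loc_cyc: "loc g \<Longrightarrow> x \<in> X \<Longrightarrow> act (cyc g x) x = g x"
  using cyc_eqI unfolding loc_def by fastforce

lemma loc_cyc_const:
  assumes "loc g" "x \<in> X"
  obtains W where "clopen W" "x \<in> W" "\<And>y. y \<in> W \<Longrightarrow> cyc g y = cyc g x"
proof -
  obtain W k where W: "openin T W" "x \<in> W" "\<forall>y\<in>W. g y = act k y"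
    using assms unfolding loc_def by blast
  obtain V where V: "clopen V" "x \<in> V" "V \<subseteq> W" using clopen_basis W by blast
  have k: "cyc g y = k" if "y \<in> W" for y
    using that W openin_subset[OF W(1)] by (intro cyc_eqI) auto
  show ?thesis by (rule that[OF V(1,2)]) (use k W V in auto)
qed

lemma openin_cyc:
  assumes "loc g"
  shows "openin T {x \<in> X. cyc g x \<in> K}"
proof (subst openin_subopen, intro ballI)
  fix x assume x: "x \<in> {x \<in> X. cyc g x \<in> K}"
  then obtain W where W: "clopen W" "x \<in> W" "\<And>y. y \<in> W \<Longrightarrow> cyc g y = cyc g x"
    using loc_cyc_const assms by blast
  have "W \<subseteq> {x \<in> X. cyc g x \<in> K}"
  proof
    fix y assume y: "y \<in> W"
    have "cyc g y = cyc g x" using W(3)[OF y] .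
    then show "y \<in> {x \<in> X. cyc g x \<in> K}" using x y clopen_subset[OF W(1)] by auto
  qed
  then show "\<exists>V. openin T V \<and> x \<in> V \<and> V \<subseteq> {x \<in> X. cyc g x \<in> K}"
    using W clopenD by blast
qed

text \<open>Freeness makes the cocycle unique on \<open>X\<close>; this pins down the
  \<open>SOME\<close> in \<open>index_map\<close>.\<close>

lemma orbit_cocycle_iff:
  "orbit_cocycle T \<phi> g n \<longleftrightarrow> loc g \<and> (\<forall>x\<in>X. n x = cyc g x)"
proof
  assume n: "orbit_cocycle T \<phi> g n"
  then have e: "g x = act (n x) x" if "x \<in> X" for x
    using that by (simp add: orbit_cocycle_def act_def)
  have "\<exists>W k. openin T W \<and> x \<in> W \<and> (\<forall>y\<in>W. g y = act k y)" if x: "x \<in> X" for x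
  proof (intro exI conjI ballI)
    show "openin T {y \<in> X. n y \<in> {n x}}"
      using n unfolding orbit_cocycle_def
      by (intro openin_continuous_map_preimage[where Y = "discrete_topology UNIV"]) auto
  qed (use e x in auto)
  then have "loc g" by (simp add: loc_def)
  then show "loc g \<and> (\<forall>x\<in>X. n x = cyc g x)" using e by (simp add: cyc_eqI)
next
  assume n: "loc g \<and> (\<forall>x\<in>X. n x = cyc g x)"
  have "{x \<in> X. n x \<in> U} = {x \<in> X. cyc g x \<in> U}" for U using n by auto
  then have "continuous_map T (discrete_topology UNIV) n"
    using openin_cyc n by (auto simp: continuous_map_def)
  then show "orbit_cocycle T \<phi> g n"
    using n loc_cyc by (simp add: orbit_cocycle_def act_def[symmetric])
qed

lemma loc_continuous:
  assumes "loc g"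
  shows "continuous_map T T g"
  unfolding continuous_map_def
proof (intro conjI allI impI)
  show "g \<in> X \<rightarrow> X" using loc_cyc[OF assms] by (metis Pi_I act_in)
  fix U assume U: "openin T U"
  show "openin T {x \<in> X. g x \<in> U}"
  proof (subst openin_subopen, intro ballI)
    fix x assume x: "x \<in> {x \<in> X. g x \<in> U}"
    then obtain W k where W: "openin T W" "x \<in> W" "\<forall>y\<in>W. g y = act k y"
      using assms unfolding loc_def by blast
    then show "\<exists>V. openin T V \<and> x \<in> V \<and> V \<subseteq> {x \<in> X. g x \<in> U}"
      using x openin_subset[OF W(1)] openin_pre[OF U]
      by (intro exI[of _ "W \<inter> pre k U"]) auto
  qed
qed

text \<open>The homeomorphism condition comes for free: a continuous bijection from a compact space
  to a Hausdorff space is a homeomorphism.\<close>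

lemma carrier_G: "carrier G = {g \<in> Bij X. loc g}"
proof -
  have "homeomorphic_map T T g" if "g \<in> Bij X" "loc g" for g
    using that loc_continuous[OF that(2)] compact Hausdorff
    by (intro continuous_imp_homeomorphic_map) (auto simp: Bij_def bij_betw_def)
  then show ?thesis
    unfolding topological_full_group_def using orbit_cocycle_iff by auto
qed

lemma carrierD:
  assumes "g \<in> carrier G"
  shows "loc g" "g \<in> extensional X" "bij_betw g X X" "inj_on g X" "x \<in> X \<Longrightarrow> g x \<in> X"
  using assms by (auto simp: carrier_G Bij_def bij_betw_def)

lemma carrierI: "g \<in> extensional X \<Longrightarrow> bij_betw g X X \<Longrightarrow> loc g \<Longrightarrow> g \<in> carrier G"
  by (simp add: carrier_G Bij_def)

lemma loc_inv:
  assumes "loc g" "bij_betw g X X"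
  shows "loc (restrict (inv_into X g) X)"
  unfolding loc_def
proof
  fix x assume x: "x \<in> X"
  define y where "y = inv_into X g x"
  have y: "y \<in> X" "g y = x"
    using assms(2) x bij_betw_inv_into_right[OF assms(2) x] bij_betw_inv_into[OF assms(2)]
    by (auto simp: y_def dest: bij_betwE)
  obtain W where W: "clopen W" "y \<in> W" "\<And>z. z \<in> W \<Longrightarrow> cyc g z = cyc g y"
    using loc_cyc_const[OF assms(1) y(1)] by blast
  define k where "k = cyc g y"
  have WX: "W \<subseteq> X" using clopen_subset W by auto
  have gz: "g z = act k z" if "z \<in> W" for z
    using loc_cyc[OF assms(1), of z] W(3)[OF that] that WX by (auto simp: k_def)
  have "restrict (inv_into X g) X z = act (- k) z" if z: "z \<in> act k ` W" for z
  proof -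
    obtain w where w: "w \<in> W" "z = act k w" using z by auto
    then have "inv_into X g z = w"
      using gz[of w] WX bij_betw_inv_into_left[OF assms(2), of w] by auto
    then show ?thesis using w WX by auto
  qed
  moreover have "x \<in> act k ` W" using gz[OF W(2)] y W(2) by auto
  ultimately show "\<exists>W k. openin T W \<and> x \<in> W \<and> (\<forall>y\<in>W. restrict (inv_into X g) X y = act k y)"
    using clopen_act[OF W(1)] clopenD by blast
qed

lemma loc_compose:
  assumes "loc f" "loc g"
  shows "loc (compose X f g)"
  unfolding loc_def
proof
  fix x assume x: "x \<in> X"
  obtain W k where W: "openin T W" "x \<in> W" "\<forall>y\<in>W. g y = act k y"
    using assms(2) x unfolding loc_def by blast
  obtain V l where V: "openin T V" "act k x \<in> V" "\<forall>y\<in>V. f y = act l y"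
    using assms(1) act_in[OF x, of k] unfolding loc_def by blast
  show "\<exists>W k. openin T W \<and> x \<in> W \<and> (\<forall>y\<in>W. compose X f g y = act k y)"
    using W V x openin_pre[OF V(1), of k]
    by (intro exI[of _ "W \<inter> pre k V"] exI[of _ "l + k"]) (auto simp: compose_def)
qed

lemma subgroup_G: "subgroup (carrier G) (BijGroup X)"
proof (rule group.subgroupI[OF group_BijGroup])
  show "carrier G \<subseteq> carrier (BijGroup X)" by (auto simp: carrier_G BijGroup_def)
  have "loc (\<lambda>x\<in>X. x)"
    unfolding loc_def using openin_topspace by (metis act_0 restrict_apply')
  then show "carrier G \<noteq> {}" using id_Bij by (force simp: carrier_G)
next
  fix f g assume f: "f \<in> carrier G" and g: "g \<in> carrier G"
  show "inv\<^bsub>BijGroup X\<^esub> f \<in> carrier G"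
    using f loc_inv carrierD[OF f] restrict_inv_into_Bij[of f X] by (simp add: carrier_G inv_BijGroup)
  show "f \<otimes>\<^bsub>BijGroup X\<^esub> g \<in> carrier G"
    using f g loc_compose compose_Bij[of f X g] by (simp add: carrier_G BijGroup_def)
qed

sublocale full: group G
proof -
  have "G = BijGroup X \<lparr>carrier := carrier G\<rparr>"
    unfolding topological_full_group_def by simp
  then show "group G"
    using subgroup.subgroup_is_group[OF subgroup_G group_BijGroup] by simp
qed

lemma one_G: "\<one>\<^bsub>G\<^esub> = (\<lambda>x\<in>X. x)"
  by (simp add: topological_full_group_def BijGroup_def)

lemma one_apply [simp]: "x \<in> X \<Longrightarrow> \<one>\<^bsub>G\<^esub> x = x"
  by (simp add: one_G)

lemma mult_G: "f \<in> carrier G \<Longrightarrow> g \<in> carrier G \<Longrightarrow> f \<otimes>\<^bsub>G\<^esub> g = compose X f g"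
  by (auto simp: topological_full_group_def BijGroup_def carrier_G)

lemma mult_apply [simp]:
  "f \<in> carrier G \<Longrightarrow> g \<in> carrier G \<Longrightarrow> x \<in> X \<Longrightarrow> (f \<otimes>\<^bsub>G\<^esub> g) x = f (g x)"
  by (simp add: mult_G compose_def)

lemma G_eqI: "f \<in> carrier G \<Longrightarrow> g \<in> carrier G \<Longrightarrow> (\<And>x. x \<in> X \<Longrightarrow> f x = g x) \<Longrightarrow> f = g"
  by (rule extensionalityI[of f X g]) (auto dest: carrierD)

lemma inv_apply [simp]:
  assumes "f \<in> carrier G" "x \<in> X"
  shows "(inv\<^bsub>G\<^esub> f) (f x) = x" "f ((inv\<^bsub>G\<^esub> f) x) = x"
  using assms mult_apply[of "inv\<^bsub>G\<^esub> f" f x] mult_apply[of f "inv\<^bsub>G\<^esub> f" x] by simp_all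

lemma inv_in [simp]: "f \<in> carrier G \<Longrightarrow> x \<in> X \<Longrightarrow> (inv\<^bsub>G\<^esub> f) x \<in> X"
  using carrierD(5)[of "inv\<^bsub>G\<^esub> f" x] by simp

text \<open>The levels over \<open>U\<close> with indices in \<open>F\<close> are pairwise
  disjoint.\<close>

definition sep :: "int set \<Rightarrow> 'a set \<Rightarrow> bool" where
  "sep F U \<longleftrightarrow> (\<forall>i\<in>F. \<forall>j\<in>F. \<forall>u\<in>U. \<forall>v\<in>U. act i u = act j v \<longrightarrow> i = j)"

lemma sep_mono: "sep F U \<Longrightarrow> F' \<subseteq> F \<Longrightarrow> U' \<subseteq> U \<Longrightarrow> sep F' U'"
  unfolding sep_def by blast

lemma sepD:
  assumes "sep F U" "U \<subseteq> X" "i \<in> F" "j \<in> F" "u \<in> U" "v \<in> U" "act i u = act j v"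
  shows "i = j" "u = v"
proof -
  show "i = j" using assms unfolding sep_def by blast
  with assms show "u = v" using act_inj_point by blast
qed

text \<open>For distinct \<open>i\<close>, \<open>j\<close> the points \<open>act i x\<close> and
  \<open>act j x\<close> differ by freeness; disjoint neighbourhoods of them are pulled back to
  \<open>x\<close>, and the finitely many results are intersected.\<close>

lemma sep_nbhd:
  assumes x: "x \<in> X" and F: "finite F"
  obtains W where "clopen W" "x \<in> W" "sep F W"
proof -
  have "\<exists>W. clopen W \<and> x \<in> W \<and> (\<forall>u\<in>W. \<forall>v\<in>W. act (fst p) u = act (snd p) v \<longrightarrow> fst p = snd p)"
    for p :: "int \<times> int"
  proof (cases "fst p = snd p")
    case False
    then have "act (fst p) x \<noteq> act (snd p) x" using act_free x by auto
    then obtain A B where AB: "openin T A" "openin T B" "act (fst p) x \<in> A" "act (snd p) x \<in> B" "disjnt A B"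
      using Hausdorff x unfolding Hausdorff_space_def by (meson act_in)
    have "openin T (pre (fst p) A \<inter> pre (snd p) B)" using AB openin_pre by auto
    moreover have "x \<in> pre (fst p) A \<inter> pre (snd p) B" using AB x by auto
    ultimately obtain W where "clopen W" "x \<in> W" "W \<subseteq> pre (fst p) A \<inter> pre (snd p) B"
      using clopen_basis by metis
    then show ?thesis using AB(5) by (intro exI[of _ W]) (fastforce simp: disjnt_iff)
  qed (use x in \<open>auto intro!: exI[of _ X]\<close>)
  then obtain W where W: "\<And>p. clopen (W p) \<and> x \<in> W p \<and>
      (\<forall>u\<in>W p. \<forall>v\<in>W p. act (fst p) u = act (snd p) v \<longrightarrow> fst p = snd p)" by metis
  show ?thesis
  proof (cases "F = {}")
    case True then show ?thesis using that[of X] x by (simp add: sep_def)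
  next
    case False
    show ?thesis
    proof (rule that[of "\<Inter>p\<in>F\<times>F. W p"])
      show "clopen (\<Inter>p\<in>F\<times>F. W p)" by (rule clopen_INT) (use F False W in auto)
      show "sep F (\<Inter>p\<in>F\<times>F. W p)" unfolding sep_def
      proof (intro ballI impI)
        fix i j u v
        assume *: "i \<in> F" "j \<in> F" "u \<in> (\<Inter>p\<in>F\<times>F. W p)" "v \<in> (\<Inter>p\<in>F\<times>F. W p)" "act i u = act j v"
        then have "u \<in> W (i, j)" "v \<in> W (i, j)" by auto
        then show "i = j" using W[of "(i, j)"] *(5) by (metis fst_conv snd_conv)
      qed
    qed (use W in auto)
  qed
qed

text \<open>\<open>lev U p\<close> maps the level \<open>act i ` U\<close> to \<open>act (p i) ` U\<close>. It is meaningful only if the levels moved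
  by \<open>p\<close> are disjoint, which is what \<open>sep\<close> expresses; otherwise \<open>THE\<close> is applied to a predicate
  that may have several solutions.\<close>

definition lev :: "'a set \<Rightarrow> (int \<Rightarrow> int) \<Rightarrow> 'a \<Rightarrow> 'a" where
  "lev U p = (\<lambda>x\<in>X. if \<exists>i. p i \<noteq> i \<and> act (- i) x \<in> U
     then let i = THE i. p i \<noteq> i \<and> act (- i) x \<in> U in act (p i - i) x else x)"

lemma lev_level:
  assumes s: "sep F U" and U: "U \<subseteq> X" and p: "p permutes F" and i: "i \<in> F" and u: "u \<in> U"
  shows "lev U p (act i u) = act (p i) u"
proof -
  have uX: "u \<in> X" using u U by auto
  \<comment> \<open>An index moved by \<open>p\<close> lies in \<open>F\<close>, so disjointness of
    the levels determines it. This is the uniqueness behind the \<open>THE\<close> in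
    \<open>lev\<close>.\<close>
  have eq: "j = i" if "p j \<noteq> j" "act (- j) (act i u) \<in> U" for j
  proof -
    have "j \<in> F" using p that(1) by (meson permutes_not_in)
    moreover have "act i u = act j (act (- j) (act i u))" using uX by simp
    ultimately show ?thesis using sepD(1)[OF s U i _ u that(2)] by blast
  qed
  show ?thesis
  proof (cases "p i = i")
    case True
    then have "\<not> (\<exists>j. p j \<noteq> j \<and> act (- j) (act i u) \<in> U)" using eq by blast
    then have "lev U p (act i u) = act i u" using uX by (simp only: lev_def restrict_apply act_in if_True if_False)
    then show ?thesis using True by simp
  next
    case False
    then have ex: "\<exists>j. p j \<noteq> j \<and> act (- j) (act i u) \<in> U" using u uX by (intro exI[of _ i]) simp
    have "(THE j. p j \<noteq> j \<and> act (- j) (act i u) \<in> U) = i"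
      by (rule the_equality) (use False u uX eq in auto)
    then show ?thesis using ex uX by (simp only: lev_def Let_def restrict_apply act_in if_True act_act) simp
  qed
qed

lemma lev_off:
  assumes p: "p permutes F" and x: "x \<in> X" and "\<And>i. i \<in> F \<Longrightarrow> act (- i) x \<notin> U"
  shows "lev U p x = x"
proof -
  have "\<not> (\<exists>i. p i \<noteq> i \<and> act (- i) x \<in> U)" using assms(3) p by (meson permutes_not_in)
  then show ?thesis using x by (simp only: lev_def restrict_apply if_True if_False)
qed

lemma level_cases:
  assumes "x \<in> X"
  obtains i u where "i \<in> F" "u \<in> U" "x = act i u" | "\<And>i. i \<in> F \<Longrightarrow> act (- i) x \<notin> U"
proof (cases "\<exists>i\<in>F. act (- i) x \<in> U")
  case True
  then obtain i where i: "i \<in> F" "act (- i) x \<in> U" by auto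
  show ?thesis by (rule that(1)[OF i]) (use assms in simp)
qed (use that in blast)

lemma lev_ext: "lev U p \<in> extensional X" by (simp add: lev_def)

lemma lev_off':
  assumes "p permutes F" "sep F V" "V \<subseteq> X" "U \<subseteq> V" "u \<in> V - U" "i \<in> F"
  shows "lev U p (act i u) = act i u"
proof (rule lev_off[OF assms(1)])
  show "act i u \<in> X" using assms by auto
  fix j assume j: "j \<in> F"
  show "act (- j) (act i u) \<notin> U"
  proof
    assume a: "act (- j) (act i u) \<in> U"
    have "act i u = act j (act (- j) (act i u))" using assms(3,5) by (auto simp: subset_iff)
    then show False
      using sepD(2)[OF assms(2,3) assms(6) j, of u "act (- j) (act i u)"] a assms by auto
  qed
qed

lemma lev_comp_apply:
  assumes "sep F U" "U \<subseteq> X" "p permutes F" "q permutes F" "x \<in> X"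
  shows "lev U p (lev U q x) = lev U (p \<circ> q) x"
proof -
  have pq: "(p \<circ> q) permutes F" using assms by (simp add: permutes_compose)
  show ?thesis using assms(5)
  proof (cases rule: level_cases[where F = F and U = U])
    case (1 i u)
    moreover have "q i \<in> F" using 1 assms(4) by (simp add: permutes_in_image)
    ultimately show ?thesis
      using lev_level[OF assms(1,2,4)] lev_level[OF assms(1,2,3)] lev_level[OF assms(1,2) pq] by simp
  next
    case 2
    then show ?thesis using lev_off assms pq by metis
  qed
qed

lemma lev_id: "lev U id = \<one>\<^bsub>G\<^esub>"
  by (auto simp: lev_def one_G)

lemma lev_in_X:
  assumes "sep F U" "U \<subseteq> X" "p permutes F" "x \<in> X"
  shows "lev U p x \<in> X"
  using assms(4)
proof (cases rule: level_cases[where F = F and U = U])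
  case (1 i u)
  then show ?thesis using lev_level[OF assms(1-3)] assms(2) by auto
qed (use lev_off assms in metis)

text \<open>The inverse permutation provides the inverse map, and on level \<open>i\<close> the map
  is the single power \<open>p i - i\<close>.\<close>

lemma lev_carrier:
  assumes s: "sep F U" and U: "clopen U" and p: "p permutes F" and F: "finite F"
  shows "lev U p \<in> carrier G"
proof (rule carrierI[OF lev_ext])
  have UX: "U \<subseteq> X" using U clopen_subset by auto
  have ip: "inv_into UNIV p permutes F" using p by (rule permutes_inv)
  have "lev U p (lev U (inv_into UNIV p) x) = x" "lev U (inv_into UNIV p) (lev U p x) = x" if x: "x \<in> X" for x
    using lev_comp_apply[OF s UX p ip x] lev_comp_apply[OF s UX ip p x] x
    by (simp_all add: permutes_inv_o[OF p] lev_id)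
  then show "bij_betw (lev U p) X X"
    by (intro bij_betw_byWitness[where f' = "lev U (inv_into UNIV p)"])
      (use lev_in_X[OF s UX p] lev_in_X[OF s UX ip] in auto)
  show "loc (lev U p)"
    unfolding loc_def
  proof
    fix x assume "x \<in> X"
    then show "\<exists>W k. openin T W \<and> x \<in> W \<and> (\<forall>y\<in>W. lev U p y = act k y)"
    proof (cases rule: level_cases[where F = F and U = U])
      case (1 i u)
      have "lev U p y = act (p i - i) y" if "y \<in> act i ` U" for y
        using that lev_level[OF s UX p 1(1)] UX by auto
      then show ?thesis using clopen_act[OF U] clopenD 1 by blast
    next
      case 2
      let ?W = "X - (\<Union>i\<in>F. pre (- i) U)"
      have "openin T ?W"
        using clopen_Diff[OF clopen_X clopen_UN[OF F, of "\<lambda>i. pre (- i) U"]] clopen_pre[OF U] clopenD by blast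
      moreover have "\<forall>y\<in>?W. lev U p y = act 0 y" using lev_off[OF p] by simp
      ultimately show ?thesis using 2 \<open>x \<in> X\<close> by (intro exI[of _ ?W] exI[of _ 0]) auto
    qed
  qed
qed

lemma lev_mult:
  assumes "sep F U" "clopen U" "p permutes F" "q permutes F" "finite F"
  shows "lev U p \<otimes>\<^bsub>G\<^esub> lev U q = lev U (p \<circ> q)"
  using assms lev_carrier permutes_compose[of q F p] lev_comp_apply[OF assms(1) clopen_subset]
  by (intro G_eqI) auto

lemma lev_inv:
  assumes "sep F U" "clopen U" "p permutes F" "finite F"
  shows "inv\<^bsub>G\<^esub> (lev U p) = lev U (inv_into UNIV p)"
  using assms lev_mult[OF assms(1,2) permutes_inv[OF assms(3)] assms(3,4)] lev_carrier permutes_inv[OF assms(3)]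
  by (intro full.inv_equality) (auto simp: permutes_inv_o[OF assms(3)] lev_id)

text \<open>The two factors have disjoint supports because all levels over the union are disjoint.
  Every reduction to small \<open>U\<close> rests on this.\<close>

lemma lev_Un:
  assumes s: "sep F (U \<union> V)" and U: "clopen U" "clopen V" and d: "U \<inter> V = {}"
    and p: "p permutes F" and F: "finite F"
  shows "lev (U \<union> V) p = lev U p \<otimes>\<^bsub>G\<^esub> lev V p"
proof -
  have sU: "sep F U" and sV: "sep F V" using sep_mono[OF s] by auto
  have UV: "clopen (U \<union> V)" using U clopen_Un by auto
  have sub: "U \<subseteq> X" "V \<subseteq> X" "U \<union> V \<subseteq> X" using clopen_subset U UV by auto
  have c: "lev U p \<in> carrier G" "lev V p \<in> carrier G" "lev (U \<union> V) p \<in> carrier G"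
    using lev_carrier U UV s sU sV p F by auto
  show ?thesis
  proof (rule G_eqI)
    fix x assume x: "x \<in> X"
    have "lev (U \<union> V) p x = lev U p (lev V p x)" using x
    proof (cases rule: level_cases[where F = F and U = "U \<union> V"])
      case (1 i u)
      have i: "p i \<in> F" using 1 p by (simp add: permutes_in_image)
      show ?thesis
      proof (cases "u \<in> U")
        case True
        then have "lev V p x = x" using lev_off'[OF p s sub(3), of V u i] d 1 by auto
        then show ?thesis using lev_level[OF s sub(3) p 1(1,2)] lev_level[OF sU sub(1) p 1(1) True] 1 by simp
      next
        case False
        then have v: "u \<in> V" using 1 by auto
        have "lev U p (act (p i) u) = act (p i) u" using lev_off'[OF p s sub(3), of U u "p i"] d False v i by auto
        then show ?thesis using lev_level[OF s sub(3) p 1(1,2)] lev_level[OF sV sub(2) p 1(1) v] 1 by simp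
      qed
    next
      case 2
      then show ?thesis using lev_off[OF p x, of "U \<union> V"] lev_off[OF p x, of U] lev_off[OF p x, of V] by simp
    qed
    then show "lev (U \<union> V) p x = (lev U p \<otimes>\<^bsub>G\<^esub> lev V p) x" using c x by simp
  qed (use c in auto)
qed

text \<open>If \<open>g\<close> carries level \<open>i\<close> to level \<open>q i\<close> by one
  power of \<open>\<phi>\<close>, conjugation by \<open>g\<close> merely renames the levels.\<close>

lemma lev_conj:
  assumes g: "g \<in> carrier G" and U: "clopen U" and s: "sep F U" and F: "finite F"
    and p: "p permutes F" and p': "p' permutes (q ` F)"
    and gq: "\<And>i u. i \<in> F \<Longrightarrow> u \<in> U \<Longrightarrow> g (act i u) = act (q i) u"
    and pq: "\<And>i. i \<in> F \<Longrightarrow> p' (q i) = q (p i)"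
  shows "sep (q ` F) U" "g \<otimes>\<^bsub>G\<^esub> lev U p \<otimes>\<^bsub>G\<^esub> inv\<^bsub>G\<^esub> g = lev U p'"
proof -
  have UX: "U \<subseteq> X" using U clopen_subset by auto
  show s': "sep (q ` F) U" unfolding sep_def
  proof (intro ballI impI)
    fix a b u v assume a: "a \<in> q ` F" "b \<in> q ` F" "u \<in> U" "v \<in> U" "act a u = act b v"
    then obtain i j where ij: "i \<in> F" "j \<in> F" "a = q i" "b = q j" by auto
    then have "g (act i u) = g (act j v)" using gq a by simp
    then have "act i u = act j v"
      using carrierD(4)[OF g] a UX by (meson act_in inj_onD subset_iff)
    then show "a = b" using sepD(1)[OF s UX ij(1,2) a(3,4)] ij by simp
  qed
  have c: "lev U p \<in> carrier G" "lev U p' \<in> carrier G"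
    using lev_carrier[OF s U p F] lev_carrier[OF s' U p'] F by auto
  have "g \<otimes>\<^bsub>G\<^esub> lev U p = lev U p' \<otimes>\<^bsub>G\<^esub> g"
  proof (rule G_eqI)
    fix x assume x: "x \<in> X"
    have gx: "g x \<in> X" using carrierD(5)[OF g x] .
    have "g (lev U p x) = lev U p' (g x)" using x
    proof (cases rule: level_cases[where F = F and U = U])
      case (1 i u)
      have i: "p i \<in> F" using 1 p by (simp add: permutes_in_image)
      show ?thesis
        using lev_level[OF s UX p 1(1,2)] lev_level[OF s' UX p' imageI[OF 1(1)] 1(2)] gq[OF 1(1,2)] gq[OF i 1(2)]
          pq[OF 1(1)] 1(3) by simp
    next
      case 2
      have "lev U p' (g x) = g x"
      proof (rule lev_off[OF p' gx])
        fix j assume "j \<in> q ` F"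
        then obtain i where i: "i \<in> F" "j = q i" by auto
        show "act (- j) (g x) \<notin> U"
        proof
          assume a: "act (- j) (g x) \<in> U"
          have "g x = act j (act (- j) (g x))" using gx by simp
          also have "\<dots> = g (act i (act (- j) (g x)))" using gq[OF i(1) a] i by simp
          finally have "x = act i (act (- j) (g x))"
            using carrierD(4)[OF g] x gx by (meson act_in inj_onD)
          then have "act (- i) x = act (- j) (g x)"
            using gx by (metis act_0 act_act act_in add.left_inverse)
          then show False using 2[OF i(1)] i(2) a by simp
        qed
      qed
      then show ?thesis using lev_off[OF p x 2] by simp
    qed
    then show "(g \<otimes>\<^bsub>G\<^esub> lev U p) x = (lev U p' \<otimes>\<^bsub>G\<^esub> g) x" using c g x gx by simp
  qed (use c g in auto)
  then have "g \<otimes>\<^bsub>G\<^esub> lev U p \<otimes>\<^bsub>G\<^esub> inv\<^bsub>G\<^esub> g = lev U p' \<otimes>\<^bsub>G\<^esub> g \<otimes>\<^bsub>G\<^esub> inv\<^bsub>G\<^esub> g" by simp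
  also have "\<dots> = lev U p'" using c g by (simp add: full.m_assoc)
  finally show "g \<otimes>\<^bsub>G\<^esub> lev U p \<otimes>\<^bsub>G\<^esub> inv\<^bsub>G\<^esub> g = lev U p'" .
qed

text \<open>The cocycle is locally constant at each of the finitely many points
  \<open>act i x\<close>; the neighbourhoods are pulled back to \<open>x\<close>.\<close>

lemma cyc_nbhd:
  assumes g: "loc g" and x: "x \<in> X" and F: "finite F"
  obtains W where "clopen W" "x \<in> W" "sep F W"
    "\<And>i y. i \<in> F \<Longrightarrow> y \<in> W \<Longrightarrow> cyc g (act i y) = cyc g (act i x)"
    "\<And>i y. i \<in> F \<Longrightarrow> y \<in> W \<Longrightarrow> g (act i y) = act (i + cyc g (act i x)) y"
proof -
  obtain W0 where W0: "clopen W0" "x \<in> W0" "sep F W0" using sep_nbhd[OF x F] .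
  have "\<exists>W. clopen W \<and> x \<in> W \<and> (\<forall>y\<in>W. cyc g (act i y) = cyc g (act i x))" for i
  proof -
    obtain W where W: "clopen W" "act i x \<in> W" "\<And>y. y \<in> W \<Longrightarrow> cyc g y = cyc g (act i x)"
      using loc_cyc_const[OF g act_in[OF x]] by blast
    show ?thesis
    proof (intro exI[of _ "pre i W"] conjI ballI)
      show "clopen (pre i W)" using W(1) by (rule clopen_pre)
      show "x \<in> pre i W" using x W(2) by simp
      fix y assume "y \<in> pre i W"
      then have "act i y \<in> W" by simp
      then show "cyc g (act i y) = cyc g (act i x)" by (rule W(3))
    qed
  qed
  then obtain W where W: "\<And>i. clopen (W i) \<and> x \<in> W i \<and> (\<forall>y\<in>W i. cyc g (act i y) = cyc g (act i x))"
    by metis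
  \<comment> \<open>The complement of a union, unlike an intersection over \<open>F\<close>, also
    behaves well for empty \<open>F\<close>.\<close>
  let ?W = "W0 \<inter> X - (\<Union>i\<in>F. X - W i)"
  have c: "clopen ?W" by (intro clopen_Diff clopen_Int clopen_UN F) (use W0 W in auto)
  have const: "cyc g (act i y) = cyc g (act i x)" if "i \<in> F" "y \<in> ?W" for i y
    using that W by blast
  show ?thesis
  proof (rule that[OF c _ _ const])
    show "sep F ?W" using W0(3) by (rule sep_mono) auto
    show "x \<in> ?W" using W W0(2) x by blast
    fix i y assume iy: "i \<in> F" "y \<in> ?W"
    then have y: "y \<in> X" by simp
    have "g (act i y) = act (cyc g (act i y)) (act i y)" using loc_cyc[OF g act_in[OF y]] by simp
    also have "\<dots> = act (i + cyc g (act i x)) y" using y by (simp only: const[OF iy] act_act add.commute)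
    finally show "g (act i y) = act (i + cyc g (act i x)) y" .
  qed
qed

end

subsection \<open>Three-cycles and transpositions of levels\<close>

definition cycle3 :: "'b \<Rightarrow> 'b \<Rightarrow> 'b \<Rightarrow> 'b \<Rightarrow> 'b" where
  "cycle3 i j k = Transposition.transpose i j \<circ> Transposition.transpose j k"

lemma cycle3_permutes: "i \<in> F \<Longrightarrow> j \<in> F \<Longrightarrow> k \<in> F \<Longrightarrow> cycle3 i j k permutes F"
  by (simp add: cycle3_def permutes_compose permutes_swap_id)

lemma cycle3_apply:
  assumes "i \<noteq> j" "j \<noteq> k" "i \<noteq> k"
  shows "cycle3 i j k i = j" "cycle3 i j k j = k" "cycle3 i j k k = i"
  using assms by (auto simp: cycle3_def Transposition.transpose_def)

lemma cycle3_other: "x \<noteq> i \<Longrightarrow> x \<noteq> j \<Longrightarrow> x \<noteq> k \<Longrightarrow> cycle3 i j k x = x"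
  by (simp add: cycle3_def transpose_apply_other)

lemma cycle3_rotate: "i \<noteq> j \<Longrightarrow> j \<noteq> k \<Longrightarrow> i \<noteq> k \<Longrightarrow> cycle3 i j k = cycle3 j k i"
  by (auto simp: cycle3_def Transposition.transpose_def fun_eq_iff)

lemma cycle3_inverse: "i \<noteq> j \<Longrightarrow> j \<noteq> k \<Longrightarrow> i \<noteq> k \<Longrightarrow> cycle3 k j i \<circ> cycle3 i j k = id"
  by (auto simp: cycle3_def Transposition.transpose_def fun_eq_iff)

text \<open>Reversing the arguments of \<open>cycle3\<close> inverts it, so the left side is the
  commutator of two 3-cycles that share only the point \<open>a\<close>.\<close>

lemma cycle3_commutator:
  assumes "distinct [a, b, c, d, e]"
  shows "cycle3 a b d \<circ> cycle3 a c e \<circ> cycle3 d b a \<circ> cycle3 e c a = cycle3 a b c"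
proof
  fix x
  consider "x = a" | "x = b" | "x = c" | "x = d" | "x = e" | "x \<notin> {a, b, c, d, e}" by blast
  then show "(cycle3 a b d \<circ> cycle3 a c e \<circ> cycle3 d b a \<circ> cycle3 e c a) x = cycle3 a b c x"
    using assms by cases (auto simp: cycle3_apply cycle3_other)
qed

text \<open>Conjugation renames \<open>a\<close> to \<open>d\<close> and fixes \<open>b\<close> and
  \<open>c\<close>. The spare point \<open>e\<close> lets a 3-cycle, not a transposition, do the
  renaming.\<close>

lemma cycle3_conj:
  assumes "distinct [a, b, c, d, e]"
  shows "cycle3 a d e \<circ> cycle3 a b c \<circ> cycle3 e d a = cycle3 d b c"
proof
  fix x
  consider "x = a" | "x = b" | "x = c" | "x = d" | "x = e" | "x \<notin> {a, b, c, d, e}" by blast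
  then show "(cycle3 a d e \<circ> cycle3 a b c \<circ> cycle3 e d a) x = cycle3 d b c x"
    using assms by cases (auto simp: cycle3_apply cycle3_other)
qed

lemma (in group) inv_cancel_left:
  assumes "x \<in> carrier G" "y \<in> carrier G"
  shows "inv x \<otimes> (x \<otimes> y) = y" "x \<otimes> (inv x \<otimes> y) = y"
  using assms by (simp_all flip: m_assoc)

lemmas (in group) word_simps = m_assoc inv_mult_group inv_cancel_left

text \<open>If \<open>g\<close> moves the support of \<open>a\<close> and \<open>b\<close> off itself, the conjugate of \<open>inv a\<close> by \<open>g\<close> commutes with
  \<open>b\<close>; the commutator of \<open>a\<close> and \<open>b\<close> then lies in every normal subgroup that contains \<open>g\<close>.\<close>

lemma (in group) commutator_mod_trick:
  assumes "a \<in> carrier G" "b \<in> carrier G" "g \<in> carrier G"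
    and c: "(g \<otimes> inv a \<otimes> inv g) \<otimes> b = b \<otimes> (g \<otimes> inv a \<otimes> inv g)"
  shows "a \<otimes> b \<otimes> inv a \<otimes> inv b
    = (a \<otimes> g \<otimes> inv a \<otimes> inv g) \<otimes> (b \<otimes> inv (a \<otimes> g \<otimes> inv a \<otimes> inv g) \<otimes> inv b)"
proof -
  define d where "d = g \<otimes> inv a \<otimes> inv g"
  have d: "d \<in> carrier G" using assms by (simp add: d_def)
  have n: "a \<otimes> g \<otimes> inv a \<otimes> inv g = a \<otimes> d" using assms by (simp add: d_def m_assoc)
  have "(a \<otimes> d) \<otimes> (b \<otimes> inv (a \<otimes> d) \<otimes> inv b) = a \<otimes> (d \<otimes> b) \<otimes> inv d \<otimes> inv a \<otimes> inv b"
    using assms(1,2) d by (simp add: word_simps)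
  also have "\<dots> = a \<otimes> (b \<otimes> d) \<otimes> inv d \<otimes> inv a \<otimes> inv b" using c by (simp add: d_def)
  also have "\<dots> = a \<otimes> b \<otimes> inv a \<otimes> inv b" using assms(1,2) d by (simp add: word_simps)
  finally show ?thesis using n by simp
qed

text \<open>This is the preimage of the centralizer of the image of \<open>M\<close> in the quotient
  by \<open>N\<close>.\<close>

lemma (in group) central_mod_subgroup:
  assumes "N \<lhd> G" and M: "M \<subseteq> carrier G"
  shows "subgroup {s \<in> carrier G. \<forall>g\<in>M. g \<otimes> s \<otimes> inv g \<otimes> inv s \<in> N} G"
proof -
  interpret N: normal N G by fact
  show ?thesis
  proof (rule subgroupI; clarsimp)
    show "\<exists>s. s \<in> carrier G \<and> (\<forall>g\<in>M. g \<otimes> s \<otimes> inv g \<otimes> inv s \<in> N)"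
      by (intro exI[of _ \<one>]) (use M in auto)
  next
    fix s g assume s: "s \<in> carrier G" "\<forall>g\<in>M. g \<otimes> s \<otimes> inv g \<otimes> inv s \<in> N" and gM: "g \<in> M"
    have g: "g \<in> carrier G" using gM M by blast
    have "inv s \<otimes> inv (g \<otimes> s \<otimes> inv g \<otimes> inv s) \<otimes> s \<in> N"
      using N.inv_op_closed1[OF s(1)] s gM by blast
    moreover have "inv s \<otimes> inv (g \<otimes> s \<otimes> inv g \<otimes> inv s) \<otimes> s = g \<otimes> inv s \<otimes> inv g \<otimes> s"
      using s(1) g by (simp add: word_simps)
    ultimately show "g \<otimes> inv s \<otimes> inv g \<otimes> s \<in> N" by simp
  next
    fix s t g
    assume s: "s \<in> carrier G" "\<forall>g\<in>M. g \<otimes> s \<otimes> inv g \<otimes> inv s \<in> N"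
      and t: "t \<in> carrier G" "\<forall>g\<in>M. g \<otimes> t \<otimes> inv g \<otimes> inv t \<in> N" and gM: "g \<in> M"
    have g: "g \<in> carrier G" using gM M by blast
    have "(g \<otimes> s \<otimes> inv g \<otimes> inv s) \<otimes> (s \<otimes> (g \<otimes> t \<otimes> inv g \<otimes> inv t) \<otimes> inv s) \<in> N"
      using N.inv_op_closed2[OF s(1)] s t gM by blast
    moreover have "(g \<otimes> s \<otimes> inv g \<otimes> inv s) \<otimes> (s \<otimes> (g \<otimes> t \<otimes> inv g \<otimes> inv t) \<otimes> inv s)
        = g \<otimes> (s \<otimes> t) \<otimes> inv g \<otimes> inv (s \<otimes> t)"
      using s(1) t(1) g by (simp add: word_simps)
    ultimately show "g \<otimes> (s \<otimes> t) \<otimes> inv g \<otimes> inv (s \<otimes> t) \<in> N" by simp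
  qed
qed

context cantor_minimal
begin

section \<open>The alternating part, its normality, and swaps modulo it\<close>

definition three_cycles :: "('a \<Rightarrow> 'a) set" where
  "three_cycles = {lev U (cycle3 i j k) | U i j k. clopen U \<and> distinct [i, j, k] \<and> sep {i, j, k} U}"

definition Alt :: "('a \<Rightarrow> 'a) set" where "Alt = generate G three_cycles"

definition swaps :: "('a \<Rightarrow> 'a) set" where
  "swaps = {lev U (Transposition.transpose i j) | U i j. clopen U \<and> i \<noteq> j \<and> sep {i, j} U}"

lemma three_cycles_carrier: "three_cycles \<subseteq> carrier G"
  unfolding three_cycles_def by (auto intro!: lev_carrier cycle3_permutes)

lemma swaps_carrier: "swaps \<subseteq> carrier G"
  unfolding swaps_def by (auto intro!: lev_carrier permutes_swap_id)

lemma Alt_subgroup: "subgroup Alt G"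
  unfolding Alt_def by (rule full.generate_is_subgroup[OF three_cycles_carrier])

lemma lev_empty: "p permutes F \<Longrightarrow> lev {} p = \<one>\<^bsub>G\<^esub>"
  by (rule extensionalityI[OF lev_ext]) (auto simp: one_G lev_off)

text \<open>Only closure under products is asked of \<open>K\<close>, so \<open>K\<close> may also
  be a set of elements whose conjugates or commutators with a fixed \<open>g\<close> lie in a
  subgroup.\<close>

lemma lev_induct:
  assumes "clopen U" "sep F U" "p permutes F" "finite F"
    and one: "\<one>\<^bsub>G\<^esub> \<in> K"
    and mult: "\<And>f g. f \<in> K \<Longrightarrow> g \<in> K \<Longrightarrow> f \<otimes>\<^bsub>G\<^esub> g \<in> K"
    and loc: "\<And>x. x \<in> X \<Longrightarrow> \<exists>W. clopen W \<and> x \<in> W \<and> (\<forall>U. clopen U \<longrightarrow> U \<subseteq> W \<longrightarrow> sep F U \<longrightarrow> lev U p \<in> K)"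
  shows "lev U p \<in> K"
proof -
  have "sep F U \<longrightarrow> lev U p \<in> K"
    using assms(1)
  proof (induction U rule: clopen_induct)
    case empty
    then show ?case using lev_empty[OF assms(3)] one by simp
  next
    case (union U V)
    then show ?case using lev_Un[OF _ union(1-3) assms(3,4)] mult sep_mono[of F "U \<union> V" F] by auto
  qed (use loc in blast)
  then show ?thesis using assms(2) by blast
qed

text \<open>With the orbit of \<open>x\<close> labelled by the integers, this map is the action of
  \<open>g\<close> on the labels; it inherits injectivity from \<open>g\<close>.\<close>

lemma cyc_shift_inj:
  assumes g: "g \<in> carrier G" and x: "x \<in> X"
  shows "inj (\<lambda>i. i + cyc g (act i x))"
proof (rule injI)
  fix i j assume e: "i + cyc g (act i x) = j + cyc g (act j x)"
  have "g (act i x) = act (i + cyc g (act i x)) x" for i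
    using loc_cyc[OF carrierD(1)[OF g], of "act i x"] x by (simp add: add.commute)
  then have "g (act i x) = g (act j x)" using e by simp
  then have "act i x = act j x" using carrierD(4)[OF g] x by (meson act_in inj_onD)
  then show "i = j" using act_free x by blast
qed

text \<open>Here \<open>q\<close> is the action of \<open>g\<close> on the orbit labels of
  \<open>x\<close>. Near \<open>x\<close> it describes \<open>g\<close> on all levels in
  \<open>F\<close>, as \<open>lev_conj\<close> requires.\<close>

lemma lev_conj_nbhd:
  assumes g: "g \<in> carrier G" and x: "x \<in> X" and F: "finite F"
  obtains W q where "clopen W" "x \<in> W" "inj q"
    "\<And>U p p'. clopen U \<Longrightarrow> U \<subseteq> W \<Longrightarrow> p permutes F \<Longrightarrow> p' permutes q ` F \<Longrightarrow>
      (\<And>i. i \<in> F \<Longrightarrow> p' (q i) = q (p i)) \<Longrightarrow>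
      sep (q ` F) U \<and> g \<otimes>\<^bsub>G\<^esub> lev U p \<otimes>\<^bsub>G\<^esub> inv\<^bsub>G\<^esub> g = lev U p'"
proof -
  obtain W where W: "clopen W" "x \<in> W" "sep F W"
    "\<And>i y. i \<in> F \<Longrightarrow> y \<in> W \<Longrightarrow> g (act i y) = act (i + cyc g (act i x)) y"
    using cyc_nbhd[OF carrierD(1)[OF g] x F] by metis
  show ?thesis
  proof (rule that[OF W(1,2) cyc_shift_inj[OF g x]])
    fix U p p'
    assume U: "clopen U" "U \<subseteq> W" and p: "p permutes F" and p': "p' permutes (\<lambda>i. i + cyc g (act i x)) ` F"
      and pq: "\<And>i. i \<in> F \<Longrightarrow> p' (i + cyc g (act i x)) = p i + cyc g (act (p i) x)"
    have s: "sep F U" using sep_mono[OF W(3) _ U(2)] by auto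
    have gq: "g (act i u) = act (i + cyc g (act i x)) u" if "i \<in> F" "u \<in> U" for i u
      using W(4) that U(2) by blast
    show "sep ((\<lambda>i. i + cyc g (act i x)) ` F) U \<and> g \<otimes>\<^bsub>G\<^esub> lev U p \<otimes>\<^bsub>G\<^esub> inv\<^bsub>G\<^esub> g = lev U p'"
      using lev_conj[OF g U(1) s F p p' gq pq] by blast
  qed
qed

lemma conj_three_cycles:
  assumes g: "g \<in> carrier G" and h: "h \<in> three_cycles"
  shows "g \<otimes>\<^bsub>G\<^esub> h \<otimes>\<^bsub>G\<^esub> inv\<^bsub>G\<^esub> g \<in> Alt"
proof -
  interpret Alt: subgroup Alt G by (rule Alt_subgroup)
  obtain U i j k where h: "h = lev U (cycle3 i j k)" "clopen U" "distinct [i, j, k]" "sep {i, j, k} U"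
    using h unfolding three_cycles_def by blast
  let ?K = "{h \<in> carrier G. g \<otimes>\<^bsub>G\<^esub> h \<otimes>\<^bsub>G\<^esub> inv\<^bsub>G\<^esub> g \<in> Alt}"
  have "lev U (cycle3 i j k) \<in> ?K"
  proof (rule lev_induct[OF h(2,4)])
    show "\<one>\<^bsub>G\<^esub> \<in> ?K" using g by simp
    show "f \<otimes>\<^bsub>G\<^esub> f' \<in> ?K" if "f \<in> ?K" "f' \<in> ?K" for f f'
    proof -
      have "g \<otimes>\<^bsub>G\<^esub> (f \<otimes>\<^bsub>G\<^esub> f') \<otimes>\<^bsub>G\<^esub> inv\<^bsub>G\<^esub> g =
         (g \<otimes>\<^bsub>G\<^esub> f \<otimes>\<^bsub>G\<^esub> inv\<^bsub>G\<^esub> g) \<otimes>\<^bsub>G\<^esub> (g \<otimes>\<^bsub>G\<^esub> f' \<otimes>\<^bsub>G\<^esub> inv\<^bsub>G\<^esub> g)"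
        using that g by (simp add: full.word_simps)
      then show ?thesis using that by auto
    qed
    fix x assume x: "x \<in> X"
    obtain W q where W: "clopen W" "x \<in> W" "inj q"
      "\<And>U p p'. clopen U \<Longrightarrow> U \<subseteq> W \<Longrightarrow> p permutes {i, j, k} \<Longrightarrow> p' permutes q ` {i, j, k} \<Longrightarrow>
      (\<And>l. l \<in> {i, j, k} \<Longrightarrow> p' (q l) = q (p l)) \<Longrightarrow>
      sep (q ` {i, j, k}) U \<and> g \<otimes>\<^bsub>G\<^esub> lev U p \<otimes>\<^bsub>G\<^esub> inv\<^bsub>G\<^esub> g = lev U p'"
      by (rule lev_conj_nbhd[OF g x, of "{i, j, k}"]) (simp, blast)
    have d: "distinct [q i, q j, q k]" using h(3) W(3) by (auto simp: inj_eq)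
    show "\<exists>W. clopen W \<and> x \<in> W \<and> (\<forall>U. clopen U \<longrightarrow> U \<subseteq> W \<longrightarrow> sep {i, j, k} U \<longrightarrow> lev U (cycle3 i j k) \<in> ?K)"
    proof (intro exI[of _ W] conjI allI impI W(1,2))
      fix U assume U: "clopen U" "U \<subseteq> W" "sep {i, j, k} U"
      have pq: "cycle3 (q i) (q j) (q k) (q l) = q (cycle3 i j k l)" if "l \<in> {i, j, k}" for l
        using that h(3) d by (auto simp: cycle3_apply)
      have "sep {q i, q j, q k} U \<and>
        g \<otimes>\<^bsub>G\<^esub> lev U (cycle3 i j k) \<otimes>\<^bsub>G\<^esub> inv\<^bsub>G\<^esub> g = lev U (cycle3 (q i) (q j) (q k))"
        using W(4)[OF U(1,2) cycle3_permutes cycle3_permutes pq] by simp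
      then have "g \<otimes>\<^bsub>G\<^esub> lev U (cycle3 i j k) \<otimes>\<^bsub>G\<^esub> inv\<^bsub>G\<^esub> g \<in> three_cycles"
        unfolding three_cycles_def using U d by blast
      then show "lev U (cycle3 i j k) \<in> ?K"
        using U lev_carrier[OF U(3,1)] by (auto simp: Alt_def cycle3_permutes intro: generate.incl)
    qed
  qed (auto intro: cycle3_permutes)
  then show ?thesis using h by simp
qed

lemma Alt_normal: "Alt \<lhd> G"
proof (rule full.normalI[OF Alt_subgroup])
  interpret Alt: subgroup Alt G by (rule Alt_subgroup)
  have "g \<otimes>\<^bsub>G\<^esub> h \<otimes>\<^bsub>G\<^esub> inv\<^bsub>G\<^esub> g \<in> Alt" if g: "g \<in> carrier G" and h: "h \<in> generate G three_cycles" for g h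
    using h
  proof (induction h rule: generate.induct)
    case one then show ?case using g by simp
  next
    case (incl h) then show ?case using conj_three_cycles g by simp
  next
    case (inv h)
    have hc: "h \<in> carrier G" using three_cycles_carrier inv by blast
    have "inv\<^bsub>G\<^esub> (g \<otimes>\<^bsub>G\<^esub> h \<otimes>\<^bsub>G\<^esub> inv\<^bsub>G\<^esub> g) \<in> Alt" using conj_three_cycles[OF g inv] by simp
    then show ?case using g hc by (simp add: full.inv_mult_group full.m_assoc)
  next
    case (eng h h')
    have hc: "h \<in> carrier G" "h' \<in> carrier G" using full.generate_in_carrier[OF three_cycles_carrier] eng by blast+
    have "g \<otimes>\<^bsub>G\<^esub> (h \<otimes>\<^bsub>G\<^esub> h') \<otimes>\<^bsub>G\<^esub> inv\<^bsub>G\<^esub> g =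
         (g \<otimes>\<^bsub>G\<^esub> h \<otimes>\<^bsub>G\<^esub> inv\<^bsub>G\<^esub> g) \<otimes>\<^bsub>G\<^esub> (g \<otimes>\<^bsub>G\<^esub> h' \<otimes>\<^bsub>G\<^esub> inv\<^bsub>G\<^esub> g)"
      using hc g by (simp add: full.word_simps)
    then show ?case using eng by simp
  qed
  then show "\<forall>x\<in>carrier G. Alt #>\<^bsub>G\<^esub> x = x <#\<^bsub>G\<^esub> Alt"
    using full.normal_inv_iff Alt_subgroup normal.coset_eq by (metis Alt_def)
qed

text \<open>A product of two transpositions is the identity, a 3-cycle, or a product of two
  3-cycles, according to how many points they share.\<close>

lemma double_transpose_Alt:
  assumes s: "sep F U" and U: "clopen U" and F: "finite F"
    and ij: "a \<in> F" "b \<in> F" "c \<in> F" "d \<in> F" "a \<noteq> b" "c \<noteq> d"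
  shows "lev U (Transposition.transpose a b \<circ> Transposition.transpose c d) \<in> Alt"
proof -
  interpret Alt: subgroup Alt G by (rule Alt_subgroup)
  have c3: "lev U (Transposition.transpose i j \<circ> Transposition.transpose j k) \<in> Alt" if "{i, j, k} \<subseteq> F" "distinct [i, j, k]" for i j k
  proof -
    have "lev U (cycle3 i j k) \<in> three_cycles"
      unfolding three_cycles_def using that U sep_mono[OF s that(1) order_refl] by blast
    then show ?thesis unfolding Alt_def cycle3_def by (rule generate.incl)
  qed
  consider "{a, b} = {c, d}" | "b = c" "a \<noteq> d" | "b = d" "a \<noteq> c" | "a = c" "b \<noteq> d" | "a = d" "b \<noteq> c"
    | "distinct [a, b, c, d]" using ij by auto
  then show ?thesis
  proof cases
    case 1
    then have "Transposition.transpose a b \<circ> Transposition.transpose c d = id"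
      by (auto simp: doubleton_eq_iff transpose_commute)
    then show ?thesis by (simp add: lev_id)
  next
    case 2 then show ?thesis using c3[of a b d] ij by auto
  next
    case 3 then show ?thesis using c3[of a b c] ij by (auto simp: transpose_commute)
  next
    case 4 then show ?thesis using c3[of b a d] ij by (auto simp: transpose_commute)
  next
    case 5 then show ?thesis using c3[of b a c] ij by (auto simp: transpose_commute)
  next
    case 6
    \<comment> \<open>For disjoint transpositions, \<open>transpose b c\<close> is inserted twice in
      the middle.\<close>
    have e: "Transposition.transpose a b \<circ> Transposition.transpose c d =
        (Transposition.transpose a b \<circ> Transposition.transpose b c) \<circ> (Transposition.transpose b c \<circ> Transposition.transpose c d)"
      by (simp add: o_assoc[symmetric]) (simp add: o_assoc)
    have "lev U (Transposition.transpose a b \<circ> Transposition.transpose b c) \<otimes>\<^bsub>G\<^esub> lev U (Transposition.transpose b c \<circ> Transposition.transpose c d) \<in> Alt"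
      using c3[of a b c] c3[of b c d] 6 ij by auto
    then show ?thesis unfolding e
      by (subst (asm) lev_mult[OF s U _ _ F]) (auto intro!: permutes_compose permutes_swap_id ij)
  qed
qed

lemma swaps_central:
  assumes h: "h \<in> swaps"
  shows "h \<in> {s \<in> carrier G. \<forall>g\<in>carrier G. g \<otimes>\<^bsub>G\<^esub> s \<otimes>\<^bsub>G\<^esub> inv\<^bsub>G\<^esub> g \<otimes>\<^bsub>G\<^esub> inv\<^bsub>G\<^esub> s \<in> Alt}" (is "_ \<in> ?Z")
proof -
  interpret Alt: subgroup Alt G by (rule Alt_subgroup)
  obtain U i j where h: "h = lev U (Transposition.transpose i j)" "clopen U" "i \<noteq> j" "sep {i, j} U"
    using h unfolding swaps_def by blast
  have "g \<otimes>\<^bsub>G\<^esub> h \<otimes>\<^bsub>G\<^esub> inv\<^bsub>G\<^esub> g \<otimes>\<^bsub>G\<^esub> inv\<^bsub>G\<^esub> h \<in> Alt" if g: "g \<in> carrier G" for g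
  proof -
    let ?K = "{s \<in> carrier G. g \<otimes>\<^bsub>G\<^esub> s \<otimes>\<^bsub>G\<^esub> inv\<^bsub>G\<^esub> g \<otimes>\<^bsub>G\<^esub> inv\<^bsub>G\<^esub> s \<in> Alt}"
    have "lev U (Transposition.transpose i j) \<in> ?K"
    proof (rule lev_induct[OF h(2,4)])
      show "\<one>\<^bsub>G\<^esub> \<in> ?K" using g by simp
      show "s \<otimes>\<^bsub>G\<^esub> t \<in> ?K" if st: "s \<in> ?K" "t \<in> ?K" for s t
      proof -
        have c: "s \<in> carrier G" "t \<in> carrier G" using st by auto
        \<comment> \<open>In commutator notation: [g, st] = [g, s] s[g, t]s^-1, and
          \<open>Alt\<close> is normal.\<close>
        have "(g \<otimes>\<^bsub>G\<^esub> s \<otimes>\<^bsub>G\<^esub> inv\<^bsub>G\<^esub> g \<otimes>\<^bsub>G\<^esub> inv\<^bsub>G\<^esub> s) \<otimes>\<^bsub>G\<^esub>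
           (s \<otimes>\<^bsub>G\<^esub> (g \<otimes>\<^bsub>G\<^esub> t \<otimes>\<^bsub>G\<^esub> inv\<^bsub>G\<^esub> g \<otimes>\<^bsub>G\<^esub> inv\<^bsub>G\<^esub> t) \<otimes>\<^bsub>G\<^esub> inv\<^bsub>G\<^esub> s) \<in> Alt"
          using normal.inv_op_closed2[OF Alt_normal c(1)] st by blast
        moreover have "(g \<otimes>\<^bsub>G\<^esub> s \<otimes>\<^bsub>G\<^esub> inv\<^bsub>G\<^esub> g \<otimes>\<^bsub>G\<^esub> inv\<^bsub>G\<^esub> s) \<otimes>\<^bsub>G\<^esub>
           (s \<otimes>\<^bsub>G\<^esub> (g \<otimes>\<^bsub>G\<^esub> t \<otimes>\<^bsub>G\<^esub> inv\<^bsub>G\<^esub> g \<otimes>\<^bsub>G\<^esub> inv\<^bsub>G\<^esub> t) \<otimes>\<^bsub>G\<^esub> inv\<^bsub>G\<^esub> s)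
           = g \<otimes>\<^bsub>G\<^esub> (s \<otimes>\<^bsub>G\<^esub> t) \<otimes>\<^bsub>G\<^esub> inv\<^bsub>G\<^esub> g \<otimes>\<^bsub>G\<^esub> inv\<^bsub>G\<^esub> (s \<otimes>\<^bsub>G\<^esub> t)"
          using c g by (simp add: full.word_simps)
        ultimately show ?thesis using c by simp
      qed
      fix x assume x: "x \<in> X"
      obtain W q where W: "clopen W" "x \<in> W" "inj q"
        "\<And>U p p'. clopen U \<Longrightarrow> U \<subseteq> W \<Longrightarrow> p permutes {i, j} \<Longrightarrow> p' permutes q ` {i, j} \<Longrightarrow>
        (\<And>l. l \<in> {i, j} \<Longrightarrow> p' (q l) = q (p l)) \<Longrightarrow>
        sep (q ` {i, j}) U \<and> g \<otimes>\<^bsub>G\<^esub> lev U p \<otimes>\<^bsub>G\<^esub> inv\<^bsub>G\<^esub> g = lev U p'"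
        by (rule lev_conj_nbhd[OF g x, of "{i, j}"]) (simp, blast)
      \<comment> \<open>The old levels \<open>i\<close>, \<open>j\<close> and the new levels
        \<open>q i\<close>, \<open>q j\<close> must be separated jointly, so that the swap and its
        conjugate are permutations in one common family.\<close>
      obtain W' where W': "clopen W'" "x \<in> W'" "sep {i, j, q i, q j} W'"
        using sep_nbhd[OF x, of "{i, j, q i, q j}"] by auto
      have d: "q i \<noteq> q j" using h(3) W(3) by (auto simp: inj_eq)
      show "\<exists>W. clopen W \<and> x \<in> W \<and> (\<forall>U. clopen U \<longrightarrow> U \<subseteq> W \<longrightarrow> sep {i, j} U \<longrightarrow> lev U (Transposition.transpose i j) \<in> ?K)"
      proof (intro exI[of _ "W \<inter> W'"] conjI allI impI clopen_Int W(1) W'(1))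
        fix U assume U: "clopen U" "U \<subseteq> W \<inter> W'" "sep {i, j} U"
        have s: "sep {i, j, q i, q j} U" using sep_mono[OF W'(3)] U by auto
        have "g \<otimes>\<^bsub>G\<^esub> lev U (Transposition.transpose i j) \<otimes>\<^bsub>G\<^esub> inv\<^bsub>G\<^esub> g = lev U (Transposition.transpose (q i) (q j))"
        proof -
          have pq: "Transposition.transpose (q i) (q j) (q l) = q (Transposition.transpose i j l)" if "l \<in> {i, j}" for l
            using that by auto
          show ?thesis using W(4)[OF U(1) _ permutes_swap_id permutes_swap_id pq] U(2) by simp
        qed
        \<comment> \<open>A swap is an involution, so its commutator with \<open>g\<close> is its
          conjugate times itself: two transpositions of levels.\<close>
        moreover have "inv\<^bsub>G\<^esub> (lev U (Transposition.transpose i j)) = lev U (Transposition.transpose i j)"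
          using lev_mult[OF U(3,1), of "Transposition.transpose i j" "Transposition.transpose i j"] lev_carrier[OF U(3,1), of "Transposition.transpose i j"]
          by (intro full.inv_equality) (auto simp: permutes_swap_id lev_id)
        moreover have "lev U (Transposition.transpose (q i) (q j)) \<otimes>\<^bsub>G\<^esub> lev U (Transposition.transpose i j) \<in> Alt"
          using double_transpose_Alt[OF s U(1), of "q i" "q j" i j] d h(3)
          by (subst lev_mult[OF s U(1)]) (auto simp: permutes_swap_id)
        ultimately show "lev U (Transposition.transpose i j) \<in> ?K"
          using lev_carrier[OF U(3,1), of "Transposition.transpose i j"] by (auto simp: permutes_swap_id)
      qed (use W(2) W'(2) in auto)
    qed (auto intro: permutes_swap_id)
    then show ?thesis using h by simp
  qed
  then show ?thesis using h lev_carrier[OF h(4,2), of "Transposition.transpose i j"] by (auto simp: permutes_swap_id)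
qed

end

subsection \<open>Normal subgroups of the alternating part\<close>

lemma cycle3_inv_into:
  assumes "i \<noteq> j" "j \<noteq> k" "i \<noteq> k"
  shows "inv_into UNIV (cycle3 i j k) = cycle3 k j i"
  by (rule inv_unique_comp) (use cycle3_inverse[of i j k] cycle3_inverse[of k j i] assms in auto)

context cantor_minimal
begin

lemma lev_cycle3_inv:
  assumes "sep F U" "clopen U" "finite F" "i \<in> F" "j \<in> F" "k \<in> F" "distinct [i, j, k]"
  shows "inv\<^bsub>G\<^esub> (lev U (cycle3 i j k)) = lev U (cycle3 k j i)"
  using lev_inv[OF assms(1,2) cycle3_permutes assms(3), of i j k] assms by (simp add: cycle3_inv_into)

lemma lev_cycle3_commutator:
  assumes s: "sep F U" and U: "clopen U" and F: "finite F"
    and d: "distinct [a, b, c, d, e]" "{a, b, c, d, e} \<subseteq> F"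
  shows "lev U (cycle3 a b c) =
    lev U (cycle3 a b d) \<otimes>\<^bsub>G\<^esub> lev U (cycle3 a c e) \<otimes>\<^bsub>G\<^esub>
      inv\<^bsub>G\<^esub> (lev U (cycle3 a b d)) \<otimes>\<^bsub>G\<^esub> inv\<^bsub>G\<^esub> (lev U (cycle3 a c e))"
proof -
  have 1: "inv\<^bsub>G\<^esub> (lev U (cycle3 a b d)) = lev U (cycle3 d b a)"
    "inv\<^bsub>G\<^esub> (lev U (cycle3 a c e)) = lev U (cycle3 e c a)"
    using d by (auto intro!: lev_cycle3_inv[OF s U F])
  have p: "cycle3 a b d permutes F" "cycle3 a c e permutes F" "cycle3 d b a permutes F" "cycle3 e c a permutes F"
    using d by (auto intro!: cycle3_permutes)
  show ?thesis
    unfolding 1 cycle3_commutator[OF d(1), symmetric]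
    using p by (simp add: lev_mult[OF s U _ _ F] permutes_compose)
qed

lemma lev_cycle3_conj:
  assumes s: "sep F U" and U: "clopen U" and F: "finite F"
    and d: "distinct [a, b, c, d, e]" "{a, b, c, d, e} \<subseteq> F"
  shows "lev U (cycle3 d b c) =
    lev U (cycle3 a d e) \<otimes>\<^bsub>G\<^esub> lev U (cycle3 a b c) \<otimes>\<^bsub>G\<^esub> inv\<^bsub>G\<^esub> (lev U (cycle3 a d e))"
proof -
  have 1: "inv\<^bsub>G\<^esub> (lev U (cycle3 a d e)) = lev U (cycle3 e d a)"
    using d by (auto intro!: lev_cycle3_inv[OF s U F])
  have p: "cycle3 a d e permutes F" "cycle3 a b c permutes F" "cycle3 e d a permutes F"
    using d by (auto intro!: cycle3_permutes)
  show ?thesis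
    unfolding 1 cycle3_conj[OF d(1), symmetric]
    using p by (simp add: lev_mult[OF s U _ _ F] permutes_compose)
qed

lemma lev_cycle3_three_cycles:
  assumes "sep F U" "clopen U" "distinct [i, j, k]" "{i, j, k} \<subseteq> F"
  shows "lev U (cycle3 i j k) \<in> three_cycles"
  unfolding three_cycles_def using assms sep_mono[OF assms(1,4) order_refl] by blast

lemma three_cycles_subset_Alt: "three_cycles \<subseteq> Alt"
  unfolding Alt_def by (auto intro: generate.incl)

text \<open>Over a small set, every 3-cycle of levels is a commutator of two others as soon as two
  further levels are available.\<close>

lemma Alt_subset_derived:
  assumes H: "subgroup H G" and th: "three_cycles \<subseteq> H"
  shows "Alt \<subseteq> derived G H"
proof -
  have HG: "H \<subseteq> carrier G" using H by (rule subgroup.subset)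
  have sub: "subgroup (derived G H) G" using full.derived_is_subgroup[OF HG] .
  have "three_cycles \<subseteq> derived G H"
  proof
    fix h assume "h \<in> three_cycles"
    then obtain U i j k where h: "h = lev U (cycle3 i j k)" "clopen U" "distinct [i, j, k]" "sep {i, j, k} U"
      unfolding three_cycles_def by blast
    obtain d where d: "d \<notin> {i, j, k}" using ex_new_if_finite[of "{i, j, k}"] infinite_UNIV_int by auto
    obtain e where e: "e \<notin> {i, j, k, d}" using ex_new_if_finite[of "{i, j, k, d}"] infinite_UNIV_int by auto
    let ?F = "{i, j, k, d, e}"
    have "lev U (cycle3 i j k) \<in> derived G H"
    proof (rule lev_induct[OF h(2,4)])
      fix x assume x: "x \<in> X"
      obtain W where W: "clopen W" "x \<in> W" "sep ?F W" using sep_nbhd[OF x, of ?F] by auto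
      show "\<exists>W. clopen W \<and> x \<in> W \<and>
        (\<forall>U. clopen U \<longrightarrow> U \<subseteq> W \<longrightarrow> sep {i, j, k} U \<longrightarrow> lev U (cycle3 i j k) \<in> derived G H)"
      proof (intro exI[of _ W] conjI allI impI W(1,2))
        fix U assume U: "clopen U" "U \<subseteq> W"
        have s: "sep ?F U" using sep_mono[OF W(3) order_refl U(2)] .
        have dd: "distinct [i, j, k, d, e]" using h(3) d e by auto
        have "lev U (cycle3 i j d) \<in> H" "lev U (cycle3 i k e) \<in> H"
          using lev_cycle3_three_cycles[OF s U(1), of i j d] lev_cycle3_three_cycles[OF s U(1), of i k e] dd th by auto
        then show "lev U (cycle3 i j k) \<in> derived G H"
          unfolding derived_def lev_cycle3_commutator[OF s U(1) _ dd order_refl, simplified]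
          by (intro generate.incl) blast
      qed
    qed (use sub in \<open>auto intro: cycle3_permutes subgroup.one_closed subgroup.m_closed\<close>)
    then show "h \<in> derived G H" using h by simp
  qed
  then show ?thesis unfolding Alt_def by (rule full.generate_subgroup_incl[OF _ sub])
qed

lemma disjoint_support_commute:
  assumes f: "f \<in> carrier G" and g: "g \<in> carrier G"
    and fP: "\<And>x. x \<in> X \<Longrightarrow> x \<notin> P \<Longrightarrow> f x = x" and gQ: "\<And>x. x \<in> X \<Longrightarrow> x \<notin> Q \<Longrightarrow> g x = x"
    and PQ: "P \<inter> Q = {}"
  shows "f \<otimes>\<^bsub>G\<^esub> g = g \<otimes>\<^bsub>G\<^esub> f"
proof (rule G_eqI)
  fix x assume x: "x \<in> X"
  \<comment> \<open>An injective map that fixes everything outside \<open>R\<close> cannot carry a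
    point of \<open>R\<close> out of \<open>R\<close>.\<close>
  have inv: "h x \<in> R" if "h \<in> carrier G" "x \<in> R" "\<And>y. y \<in> X \<Longrightarrow> y \<notin> R \<Longrightarrow> h y = y" for h R
  proof (rule ccontr)
    assume n: "h x \<notin> R"
    then have "h (h x) = h x" using that(3) carrierD(5)[OF that(1) x] by blast
    then have "h x = x" using carrierD(4,5)[OF that(1)] x by (meson inj_onD)
    then show False using n that(2) by simp
  qed
  have "f (g x) = g (f x)"
  proof (cases "x \<in> P")
    case True
    then have "f x \<in> P" using inv[OF f _ fP] by blast
    then have "x \<notin> Q" "f x \<notin> Q" using True PQ by auto
    then show ?thesis using gQ[of x] gQ[of "f x"] x carrierD(5)[OF f x] by simp
  next
    case False
    then have fx: "f x = x" using fP x by blast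
    show ?thesis
    proof (cases "x \<in> Q")
      case True
      then have "g x \<in> Q" using inv[OF g _ gQ] by blast
      then have "g x \<notin> P" using PQ by auto
      then show ?thesis using fx fP[of "g x"] carrierD(5)[OF g x] by simp
    qed (use fx gQ x in simp)
  qed
  then show "(f \<otimes>\<^bsub>G\<^esub> g) x = (g \<otimes>\<^bsub>G\<^esub> f) x" using f g x by simp
qed (use f g in auto)

text \<open>Conjugation is available only by elements of \<open>Alt\<close>, so the 3-cycles must be
  moved to arbitrary levels by 3-cycles alone.\<close>

lemma normal_in_Alt:
  assumes N: "subgroup N G" and NA: "N \<subseteq> Alt"
    and conj: "\<And>a n. a \<in> Alt \<Longrightarrow> n \<in> N \<Longrightarrow> a \<otimes>\<^bsub>G\<^esub> n \<otimes>\<^bsub>G\<^esub> inv\<^bsub>G\<^esub> a \<in> N"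
    and nt: "N \<noteq> {\<one>\<^bsub>G\<^esub>}"
  shows "N = Alt"
proof -
  interpret N: subgroup N G by (rule N)
  interpret Alt: subgroup Alt G by (rule Alt_subgroup)
  obtain g where g: "g \<in> N" "g \<noteq> \<one>\<^bsub>G\<^esub>" using nt N.one_closed by blast
  have gc: "g \<in> carrier G" using g N.subset by auto
  obtain y where y: "y \<in> X" "g y \<noteq> y" using g(2) G_eqI[OF gc full.one_closed] by auto
  obtain A B where AB: "openin T A" "openin T B" "y \<in> A" "g y \<in> B" "disjnt A B"
    using Hausdorff y carrierD(5)[OF gc y(1)] unfolding Hausdorff_space_def by metis
  have "openin T {x \<in> X. g x \<in> B}"
    using loc_continuous[OF carrierD(1)[OF gc]] AB(2) by (rule openin_continuous_map_preimage)
  then have "openin T (A \<inter> {x \<in> X. g x \<in> B})" using AB by auto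
  moreover have "y \<in> A \<inter> {x \<in> X. g x \<in> B}" using AB y by auto
  ultimately obtain V where V: "clopen V" "y \<in> V" "V \<subseteq> A \<inter> {x \<in> X. g x \<in> B}"
    using clopen_basis[of "A \<inter> {x \<in> X. g x \<in> B}" y] by blast
  have disj: "g ` V \<inter> V = {}" using V AB(5) by (auto simp: disjnt_iff)
  obtain H where H: "H \<ge> 0" "\<And>x. x \<in> X \<Longrightarrow> \<exists>k. 0 \<le> k \<and> k \<le> H \<and> act k x \<in> V"
    using bounded_gaps[of V] V clopenD by blast
  \<comment> \<open>Visits to \<open>V\<close> occur at arbitrarily late times; this keeps the
    levels inside \<open>V\<close> distinct from any levels given before.\<close>
  have big: "\<exists>k. act k x \<in> V \<and> k > b" if x: "x \<in> X" for x b
  proof -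
    obtain k where k: "0 \<le> k" "act k (act (b + 1) x) \<in> V" using H(2)[OF act_in[OF x]] by blast
    then show ?thesis using x by (intro exI[of _ "k + (b + 1)"]) simp
  qed
  have "three_cycles \<subseteq> N"
  proof
    fix h assume "h \<in> three_cycles"
    then obtain U i j k where h: "h = lev U (cycle3 i j k)" "clopen U" "distinct [i, j, k]" "sep {i, j, k} U"
      unfolding three_cycles_def by blast
    have "lev U (cycle3 i j k) \<in> N"
    proof (rule lev_induct[OF h(2,4)])
      fix x assume x: "x \<in> X"
      \<comment> \<open>Five increasing visiting times beyond \<open>b\<close> give, with
        \<open>i\<close>, \<open>j\<close>, \<open>k\<close>, eight distinct levels: five are what
        the commutator identity for 3-cycles needs inside \<open>V\<close>.\<close>
      obtain b where b: "i \<le> b" "j \<le> b" "k \<le> b" by (metis linear order_trans)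
      obtain a1 where a1: "act a1 x \<in> V" "a1 > b" using big[OF x] by blast
      obtain a2 where a2: "act a2 x \<in> V" "a2 > a1" using big[OF x] by blast
      obtain a3 where a3: "act a3 x \<in> V" "a3 > a2" using big[OF x] by blast
      obtain a4 where a4: "act a4 x \<in> V" "a4 > a3" using big[OF x] by blast
      obtain a5 where a5: "act a5 x \<in> V" "a5 > a4" using big[OF x] by blast
      let ?F = "{i, j, k, a1, a2, a3, a4, a5}"
      have fin: "finite ?F" by simp
      obtain W where W: "clopen W" "x \<in> W" "sep ?F W" using sep_nbhd[OF x fin] .
      \<comment> \<open>Over subsets of \<open>W'\<close> the levels \<open>a1\<close> to
        \<open>a5\<close> lie inside \<open>V\<close>.\<close>
      define W' where "W' = W \<inter> (\<Inter>a\<in>{a1, a2, a3, a4, a5}. pre a V)"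
      have W': "clopen W'" unfolding W'_def using W V(1) by (simp add: clopen_Int clopen_pre)
      have xW': "x \<in> W'" using W x a1 a2 a3 a4 a5 by (simp add: W'_def)
      show "\<exists>W. clopen W \<and> x \<in> W \<and>
        (\<forall>U. clopen U \<longrightarrow> U \<subseteq> W \<longrightarrow> sep {i, j, k} U \<longrightarrow> lev U (cycle3 i j k) \<in> N)"
      proof (intro exI[of _ W'] conjI allI impI W' xW')
        fix U assume U: "clopen U" "U \<subseteq> W'"
        have UW: "U \<subseteq> W" using U by (auto simp: W'_def)
        have UX: "U \<subseteq> X" using U clopen_subset by auto
        have s: "sep ?F U" using sep_mono[OF W(3) order_refl UW] .
        have ne: "i \<noteq> j" "i \<noteq> k" "j \<noteq> k" using h(3) by auto
        have A3: "lev U (cycle3 p q r) \<in> Alt" if "{p, q, r} \<subseteq> ?F" "distinct [p, q, r]" for p q r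
          using lev_cycle3_three_cycles[OF s U(1) that(2,1)] three_cycles_subset_Alt by blast
        define \<alpha> where "\<alpha> = lev U (cycle3 a1 a2 a4)"
        define \<beta> where "\<beta> = lev U (cycle3 a1 a3 a5)"
        have A: "\<alpha> \<in> Alt" "\<beta> \<in> Alt"
          unfolding \<alpha>_def \<beta>_def using a1 a2 a3 a4 a5 by (auto intro!: A3)
        then have c: "\<alpha> \<in> carrier G" "\<beta> \<in> carrier G" using Alt.subset by auto
        have lev_V: "lev U p x = x" if "x \<in> X" "x \<notin> V" "p permutes {a1, a2, a3, a4, a5}" for p x
        proof (rule lev_off[OF that(3,1)])
          fix l assume "l \<in> {a1, a2, a3, a4, a5}"
          then show "act (- l) x \<notin> U" using U(2) that(1,2) by (auto simp: W'_def)
        qed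
        have sup: "\<alpha> x = x" "\<beta> x = x" if "x \<in> X" "x \<notin> V" for x
          unfolding \<alpha>_def \<beta>_def using that by (auto intro!: lev_V cycle3_permutes)
        have c\<delta>: "g \<otimes>\<^bsub>G\<^esub> inv\<^bsub>G\<^esub> \<alpha> \<otimes>\<^bsub>G\<^esub> inv\<^bsub>G\<^esub> g \<in> carrier G" using c gc by simp
        \<comment> \<open>The conjugate is supported in the image of \<open>V\<close> under
          \<open>g\<close>, which is disjoint from \<open>V\<close> and hence from the support of
          \<open>\<beta>\<close>.\<close>
        have sup\<delta>: "(g \<otimes>\<^bsub>G\<^esub> inv\<^bsub>G\<^esub> \<alpha> \<otimes>\<^bsub>G\<^esub> inv\<^bsub>G\<^esub> g) x = x" if x: "x \<in> X" "x \<notin> g ` V" for x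
        proof -
          define z where "z = (inv\<^bsub>G\<^esub> g) x"
          have z: "z \<in> X" "g z = x" using x gc by (auto simp: z_def)
          have "z \<notin> V" using z x by auto
          then have "(inv\<^bsub>G\<^esub> \<alpha>) z = z" using sup(1)[OF z(1)] inv_apply(1)[OF c(1) z(1)] by simp
          then show ?thesis using x c gc z by (simp add: z_def[symmetric])
        qed
        have "(g \<otimes>\<^bsub>G\<^esub> inv\<^bsub>G\<^esub> \<alpha> \<otimes>\<^bsub>G\<^esub> inv\<^bsub>G\<^esub> g) \<otimes>\<^bsub>G\<^esub> \<beta> = \<beta> \<otimes>\<^bsub>G\<^esub> (g \<otimes>\<^bsub>G\<^esub> inv\<^bsub>G\<^esub> \<alpha> \<otimes>\<^bsub>G\<^esub> inv\<^bsub>G\<^esub> g)"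
          by (rule disjoint_support_commute[OF c\<delta> c(2) sup\<delta> sup(2) disj])
        note tr = full.commutator_mod_trick[OF c gc this]
        have n: "\<alpha> \<otimes>\<^bsub>G\<^esub> g \<otimes>\<^bsub>G\<^esub> inv\<^bsub>G\<^esub> \<alpha> \<otimes>\<^bsub>G\<^esub> inv\<^bsub>G\<^esub> g \<in> N" using conj[OF A(1) g(1)] g(1) by simp
        have start: "lev U (cycle3 a1 a2 a3) \<in> N"
        proof -
          have "lev U (cycle3 a1 a2 a3) = \<alpha> \<otimes>\<^bsub>G\<^esub> \<beta> \<otimes>\<^bsub>G\<^esub> inv\<^bsub>G\<^esub> \<alpha> \<otimes>\<^bsub>G\<^esub> inv\<^bsub>G\<^esub> \<beta>"
            unfolding \<alpha>_def \<beta>_def using a1 a2 a3 a4 a5 by (intro lev_cycle3_commutator[OF s U(1) fin]) auto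
          then show ?thesis using n conj[OF A(2) N.m_inv_closed[OF n]] unfolding tr by simp
        qed
        \<comment> \<open>Replaces the first entry of a 3-cycle by \<open>d\<close>. The fifth level
          of the conjugation is always \<open>a4\<close>, which none of the 3-cycles below
          contains.\<close>
        have move: "lev U (cycle3 d q r) \<in> N"
          if "lev U (cycle3 p q r) \<in> N" "{p, q, r, d, a4} \<subseteq> ?F" "distinct [p, q, r, d, a4]" for p q r d
          using lev_cycle3_conj[OF s U(1) fin that(3,2)] conj[OF A3[of p d a4] that(1)] that(2,3) by auto
        \<comment> \<open>Rotation brings each old entry to the front in turn: \<open>a1\<close>
          becomes \<open>i\<close>, \<open>a2\<close> becomes \<open>j\<close>, \<open>a3\<close>
          becomes \<open>k\<close>.\<close>
        have "lev U (cycle3 i a2 a3) \<in> N"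
          by (rule move[OF start]) (use a1 a2 a3 a4 a5 b in auto)
        then have "lev U (cycle3 a2 a3 i) \<in> N"
          using a1 a2 a3 a4 a5 b by (subst (asm) cycle3_rotate) auto
        then have "lev U (cycle3 j a3 i) \<in> N"
          by (rule move) (use a1 a2 a3 a4 a5 b ne in auto)
        then have "lev U (cycle3 a3 i j) \<in> N"
          using a1 a2 a3 a4 a5 b ne by (subst (asm) cycle3_rotate) auto
        then have "lev U (cycle3 k i j) \<in> N"
          by (rule move) (use a1 a2 a3 a4 a5 b ne in auto)
        then show "lev U (cycle3 i j k) \<in> N"
          using ne by (subst (asm) cycle3_rotate) auto
      qed
    qed (auto intro: cycle3_permutes)
    then show "h \<in> N" using h by simp
  qed
  then have "Alt \<subseteq> N" unfolding Alt_def by (rule full.generate_subgroup_incl[OF _ N])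
  then show ?thesis using NA by auto
qed

lemma Alt_nontrivial: "Alt \<noteq> {\<one>\<^bsub>G\<^esub>}"
proof -
  obtain x where x: "x \<in> X" using X_ne by blast
  obtain W where W: "clopen W" "x \<in> W" "sep {0, 1, 2} W" using sep_nbhd[OF x, of "{0, 1, 2}"] by auto
  have "lev W (cycle3 0 1 2) \<in> Alt"
    using lev_cycle3_three_cycles[OF W(3,1), of 0 1 2] three_cycles_subset_Alt by auto
  moreover have "lev W (cycle3 0 1 2) (act 0 x) = act 1 x"
    by (subst lev_level[OF W(3) clopen_subset[OF W(1)] cycle3_permutes]) (auto simp: W(2) cycle3_apply)
  then have "lev W (cycle3 0 1 2) x \<noteq> x" using act_free[OF x, of 1 0] by auto
  then have "lev W (cycle3 0 1 2) \<noteq> \<one>\<^bsub>G\<^esub>" using x by auto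
  ultimately show ?thesis by auto
qed

end

subsection \<open>Decomposition along Kakutani--Rohlin towers\<close>

lemma permutation_between:
  assumes F: "finite F" and A: "A \<subseteq> F" and B: "B \<subseteq> F" and c: "card A = card B"
  obtains p where "p permutes F" "\<And>x. x \<in> F \<Longrightarrow> p x \<in> B \<longleftrightarrow> x \<in> A"
proof -
  have fin: "finite A" "finite B" "finite (F - A)" "finite (F - B)"
    using F A B finite_subset by auto
  obtain f where f: "bij_betw f A B" using finite_same_card_bij[OF fin(1,2) c] by auto
  have "card (F - A) = card (F - B)" using A B c fin by (simp add: card_Diff_subset)
  then obtain g where g: "bij_betw g (F - A) (F - B)" using finite_same_card_bij fin by blast
  define p where "p x = (if x \<in> A then f x else if x \<in> F then g x else x)" for x
  have pA: "bij_betw p A B" using f by (simp add: p_def cong: bij_betw_cong)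
  have pD: "bij_betw p (F - A) (F - B)" using g by (subst bij_betw_cong[where g = g]) (auto simp: p_def)
  have "bij_betw p (A \<union> (F - A)) (B \<union> (F - B))"
    by (rule bij_betw_combine[OF pA pD]) auto
  moreover have "A \<union> (F - A) = F" "B \<union> (F - B) = F" using A B by auto
  ultimately have bF: "bij_betw p F F" by simp
  show ?thesis
  proof (rule that)
    show "p permutes F" by (rule bij_imp_permutes[OF bF]) (use A in \<open>auto simp: p_def\<close>)
    show "p x \<in> B \<longleftrightarrow> x \<in> A" if "x \<in> F" for x
      using bij_betwE[OF pA] bij_betwE[OF pD] that by blast
  qed
qed

context cantor_minimal
begin

section \<open>Elements that preserve orbit segments are products of swaps\<close>

definition swap_group :: "('a \<Rightarrow> 'a) set" where "swap_group = generate G swaps"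

lemma swap_group_subgroup: "subgroup swap_group G"
  unfolding swap_group_def by (rule full.generate_is_subgroup[OF swaps_carrier])

lemma lev_swap_group:
  assumes s: "sep F U" and U: "clopen U" and F: "finite F" and p: "p permutes F"
  shows "lev U p \<in> swap_group"
  using p F
proof (induction p rule: permutes_induct)
  case id
  show ?case unfolding lev_id by (rule subgroup.one_closed[OF swap_group_subgroup])
next
  case (swap a b p)
  have "lev U (Transposition.transpose a b) \<in> swaps"
    unfolding swaps_def using swap(1-3) U sep_mono[OF s _ order_refl, of "{a, b}"] by blast
  then have "lev U (Transposition.transpose a b) \<in> swap_group" unfolding swap_group_def by (rule generate.incl)
  then have "lev U (Transposition.transpose a b) \<otimes>\<^bsub>G\<^esub> lev U p \<in> swap_group"
    by (rule subgroup.m_closed[OF swap_group_subgroup _ swap.IH])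
  then show ?case unfolding lev_mult[OF s U permutes_swap_id[OF swap(1,2)] swap.hyps(4) F] .
qed

text \<open>By the hypothesis \<open>cut\<close>, \<open>g\<close> maps the past of every visit of an orbit to \<open>C\<close> to itself. So it
  preserves the orbit segments between consecutive visits and permutes the levels of the
  Kakutani--Rohlin towers over \<open>C\<close>.\<close>

lemma segment_preserving_swap_group:
  assumes g: "g \<in> carrier G" and C: "clopen C" "C \<noteq> {}"
    and cut: "\<And>c i. c \<in> C \<Longrightarrow> i < 0 \<longleftrightarrow> i + cyc g (act i c) < 0"
  shows "g \<in> swap_group"
proof -
  have swap_group_G: "swap_group \<subseteq> carrier G" using swap_group_subgroup by (rule subgroup.subset)
  have CX: "C \<subseteq> X" using C clopen_subset by auto
  \<comment> \<open>\<open>bk y\<close> is the time since the last visit to \<open>C\<close>, zero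
    on \<open>C\<close> itself, and \<open>base y\<close> is the point of that visit: height and
    foot of \<open>y\<close> in its tower.\<close>
  define bk where "bk y = (LEAST n. act (- int n) y \<in> C)" for y
  define base where "base y = act (- int (bk y)) y" for y
  obtain H where H: "H \<ge> 0" "\<And>x. x \<in> X \<Longrightarrow> \<exists>k. 0 \<le> k \<and> k \<le> H \<and> act k x \<in> C"
    using bounded_gaps[OF _ C(2)] C(1) clopenD by blast
  have ex: "\<exists>n. act (- int n) y \<in> C" if y: "y \<in> X" for y
  proof -
    \<comment> \<open>A forward visit from \<open>act (- H) y\<close> within time \<open>H\<close>
      is a visit of \<open>y\<close> at a time that is not positive.\<close>
    obtain k where k: "0 \<le> k" "k \<le> H" "act k (act (- H) y) \<in> C" using H(2)[OF act_in[OF y]] by blast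
    then show ?thesis using y by (intro exI[of _ "nat (H - k)"]) simp
  qed
  have base_C: "base y \<in> C" if "y \<in> X" for y
    unfolding base_def bk_def using LeastI_ex[OF ex[OF that]] .
  have bk_min: "act (- int m) y \<notin> C" if "m < bk y" for m y
    using not_less_Least that unfolding bk_def by blast
  have bk_eq: "bk (act (int n) c) = n" "base (act (int n) c) = c"
    if c: "c \<in> C" and n: "\<And>m. 0 < m \<Longrightarrow> m \<le> n \<Longrightarrow> act (int m) c \<notin> C" for c n
  proof -
    have cX: "c \<in> X" using c CX by auto
    show b: "bk (act (int n) c) = n"
      unfolding bk_def
    proof (rule Least_equality)
      show "act (- int n) (act (int n) c) \<in> C" using c cX by simp
      fix m assume m: "act (- int m) (act (int n) c) \<in> C"
      show "n \<le> m"
      proof (rule ccontr)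
        assume "\<not> n \<le> m"
        then have "act (int (n - m)) c \<in> C" using m cX by (simp add: of_nat_diff)
        then show False using n[of "n - m"] \<open>\<not> n \<le> m\<close> by simp
      qed
    qed
    show "base (act (int n) c) = c" unfolding base_def b using cX by simp
  qed
  have decomp: "y = act (int (bk y)) (base y)" if "y \<in> X" for y
    unfolding base_def using that by simp
  have base_notC: "act (int m) (base y) \<notin> C" if y: "y \<in> X" and m: "0 < m" "m \<le> bk y" for y m
  proof -
    have "act (int m) (base y) = act (- int (bk y - m)) y"
      unfolding base_def using y m by (simp add: of_nat_diff)
    then show ?thesis using bk_min[of "bk y - m" y] m by simp
  qed
  have g_shift: "g (act i c) = act (i + cyc g (act i c)) c" if "c \<in> X" for i c
    using loc_cyc[OF carrierD(1)[OF g], of "act i c"] that by (simp add: add.commute)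
  have base_g: "base (g y) = base y" if y: "y \<in> X" for y
  proof -
    define c where "c = base y"
    define i where "i = int (bk y)"
    define j where "j = i + cyc g (act i c)"
    have c: "c \<in> C" "c \<in> X" using base_C[OF y] CX by (auto simp: c_def)
    have yi: "y = act i c" using decomp[OF y] by (simp add: i_def c_def)
    have gy: "g y = act j c" using g_shift[OF c(2)] yi by (simp add: j_def)
    have "i \<ge> 0" by (simp add: i_def)
    then have j0: "j \<ge> 0" using cut[OF c(1), of i] by (simp add: j_def)
    have "act (int m) c \<notin> C" if m: "0 < m" "m \<le> nat j" for m
    proof
      assume a: "act (int m) c \<in> C"
      \<comment> \<open>If \<open>g y\<close> lay beyond a later visit \<open>c'\<close>, then
        \<open>cut\<close> at \<open>c'\<close> would place \<open>y\<close> beyond it too, although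
        \<open>base y\<close> is the last visit before \<open>y\<close>.\<close>
      define c' where "c' = act (int m) c"
      have c': "c' \<in> C" using a by (simp add: c'_def)
      have "act (i - int m) c' = y" using yi c(2) by (simp add: c'_def)
      then have "i - int m < 0 \<longleftrightarrow> i - int m + cyc g y < 0" using cut[OF c', of "i - int m"] by simp
      moreover have "j = i + cyc g y" using yi by (simp add: j_def)
      ultimately have "int m \<le> i" using m j0 by linarith
      then have "m \<le> bk y" by (simp add: i_def)
      then show False using base_notC[OF y m(1)] a by (simp add: c_def)
    qed
    then have "base (act (int (nat j)) c) = c" using bk_eq(2)[OF c(1)] by blast
    then show ?thesis using gy j0 by (simp add: c_def)
  qed
  \<comment> \<open>Applies \<open>g\<close> only to the towers with foot in \<open>U\<close>. As
    \<open>g\<close> preserves feet, \<open>tw\<close> is multiplicative over disjoint unions, and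
    induction over clopen sets reaches \<open>tw X = g\<close>.\<close>
  define tw where "tw U = (\<lambda>y\<in>X. if base y \<in> U then g y else y)" for U
  have "tw X \<in> swap_group"
    using clopen_X
  proof (induction rule: clopen_induct)
    case empty
    have "tw {} = \<one>\<^bsub>G\<^esub>" by (simp add: tw_def one_G)
    then show ?case using subgroup.one_closed[OF swap_group_subgroup] by simp
  next
    case (union U V)
    have "tw (U \<union> V) = tw U \<otimes>\<^bsub>G\<^esub> tw V"
    proof -
      have c: "tw U \<in> carrier G" "tw V \<in> carrier G" using union swap_group_G by auto
      show ?thesis
        unfolding mult_G[OF c]
      proof (rule extensionalityI[where A = X])
        fix y assume y: "y \<in> X"
        then show "tw (U \<union> V) y = compose X (tw U) (tw V) y"
          using union(3) base_g[OF y] carrierD(5)[OF g y] by (auto simp: tw_def compose_def)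
      qed (auto simp: tw_def)
    qed
    then show ?case using union subgroup.m_closed[OF swap_group_subgroup] by auto
  next
    case (local x)
    show ?case
    proof (cases "x \<in> C")
      case False
      have "tw U \<in> swap_group" if "U \<subseteq> X - C" for U
      proof -
        have "tw U = \<one>\<^bsub>G\<^esub>" using that base_C by (auto simp: tw_def one_G fun_eq_iff)
        then show ?thesis using subgroup.one_closed[OF swap_group_subgroup] by simp
      qed
      then show ?thesis using False local C clopen_Diff[OF clopen_X C(1)] by (intro exI[of _ "X - C"]) auto
    next
      case xC: True
      \<comment> \<open>The first return time of \<open>x\<close> to \<open>C\<close>, that is, the
        height of its tower.\<close>
      define h where "h = (LEAST n. 0 < n \<and> act (int n) x \<in> C)"
      have "\<exists>n. 0 < n \<and> act (int n) x \<in> C"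
      proof -
        obtain k where k: "0 \<le> k" "act k (act 1 x) \<in> C" using H(2)[OF act_in[OF local]] by blast
        then show ?thesis using local by (intro exI[of _ "nat (k + 1)"]) simp
      qed
      from LeastI_ex[OF this] have h: "0 < h" "act (int h) x \<in> C" unfolding h_def by auto
      have hmin: "act (int m) x \<notin> C" if "0 < m" "m < h" for m
        using that not_less_Least unfolding h_def by blast
      let ?F = "{0..<int h}"
      obtain W where W: "clopen W" "x \<in> W" "sep ?F W"
        "\<And>i y. i \<in> ?F \<Longrightarrow> y \<in> W \<Longrightarrow> g (act i y) = act (i + cyc g (act i x)) y"
        using cyc_nbhd[OF carrierD(1)[OF g] local, of ?F] by (metis finite_atLeastLessThan_int)
      \<comment> \<open>All points of \<open>W'\<close> have the same first return time
        \<open>h\<close>, so the towers over a subset have exactly the levels in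
        \<open>?F\<close>.\<close>
      define W' where "W' = W \<inter> C \<inter> pre (int h) C - (\<Union>m\<in>{0<..<h}. pre (int m) C)"
      have W': "clopen W'" unfolding W'_def
        by (intro clopen_Diff clopen_Int clopen_UN clopen_pre W C) auto
      have xW': "x \<in> W'" using W(2) xC h hmin local by (auto simp: W'_def)
      define q where "q i = i + cyc g (act i x)" for i
      have q_inj: "inj q" unfolding q_def using cyc_shift_inj[OF g local] .
      \<comment> \<open>\<open>cut\<close> at \<open>x\<close> keeps the image from falling below
        level 0, and \<open>cut\<close> at the return point \<open>act (int h) x\<close> keeps it
        below level \<open>h\<close>.\<close>
      have q_in: "q i \<in> ?F" if i: "i \<in> ?F" for i
      proof -
        have "\<not> q i < 0" using cut[OF xC, of i] i by (simp add: q_def)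
        moreover have "act (i - int h) (act (int h) x) = act i x" using local by simp
        then have "i - int h + cyc g (act i x) < 0" using cut[OF h(2), of "i - int h"] i by simp
        ultimately show ?thesis by (simp add: q_def)
      qed
      define p where "p i = (if i \<in> ?F then q i else i)" for i
      have qF: "bij_betw q ?F ?F"
      proof -
        have "inj_on q ?F" using q_inj by (rule inj_on_subset) simp
        then show ?thesis unfolding bij_betw_def
          using endo_inj_surj[of ?F q] q_in by blast
      qed
      have p: "p permutes ?F"
      proof (rule bij_imp_permutes)
        show "bij_betw p ?F ?F" using qF by (subst bij_betw_cong[where g = q]) (auto simp: p_def)
      qed (auto simp: p_def)
      have "tw U = lev U p \<and> lev U p \<in> swap_group" if U: "clopen U" "U \<subseteq> W'" for U
      proof
        have UX: "U \<subseteq> X" using U clopen_subset by auto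
        have s: "sep ?F U" by (rule sep_mono[OF W(3)]) (use U(2) in \<open>auto simp: W'_def\<close>)
        have uC: "u \<in> C" "u \<in> W" "act (int h) u \<in> C" if "u \<in> U" for u using that U(2) by (auto simp: W'_def)
        have uN: "act (int m) u \<notin> C" if "u \<in> U" "0 < m" "m < h" for u m
          using that U(2) UX by (auto simp: W'_def)
        show "lev U p \<in> swap_group" by (rule lev_swap_group[OF s U(1) _ p]) simp
        show "tw U = lev U p"
        proof (rule extensionalityI[where A = X])
          fix y assume y: "y \<in> X"
          show "tw U y = lev U p y"
          proof (cases "base y \<in> U")
            case True
            have "bk y < h"
            proof (rule ccontr)
              assume "\<not> bk y < h"
              then show False using base_notC[OF y h(1)] uC(3)[OF True] by simp
            qed
            then have i: "int (bk y) \<in> ?F" by simp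
            have "lev U p y = act (p (int (bk y))) (base y)"
              using lev_level[OF s UX p i True] decomp[OF y] by simp
            also have "\<dots> = g (act (int (bk y)) (base y))"
              using W(4)[OF i uC(2)[OF True]] i by (simp add: p_def q_def)
            also have "\<dots> = g y" using decomp[OF y] by simp
            finally show ?thesis using True y by (simp add: tw_def)
          next
            case False
            \<comment> \<open>If \<open>y\<close> lay on a level over \<open>U\<close>, the point of
              \<open>U\<close> below it would be its last visit to \<open>C\<close>, hence its
              foot.\<close>
            have "lev U p y = y"
            proof (rule lev_off[OF p y])
              fix i assume i: "i \<in> ?F"
              show "act (- i) y \<notin> U"
              proof
                assume u: "act (- i) y \<in> U"
                have "act (int m) (act (- i) y) \<notin> C" if "0 < m" "m \<le> nat i" for m
                proof -
                  have "m < h" using that(2) i by (auto simp: le_nat_iff)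
                  then show ?thesis by (rule uN[OF u that(1)])
                qed
                then have "base (act (int (nat i)) (act (- i) y)) = act (- i) y"
                  using bk_eq(2)[OF uC(1)[OF u], of "nat i"] by blast
                moreover have "act (int (nat i)) (act (- i) y) = y" using i y by simp
                ultimately show False using False u by simp
              qed
            qed
            then show ?thesis using False y by (simp add: tw_def)
          qed
        qed (auto simp: tw_def lev_ext)
      qed
      then show ?thesis using W' xW' by (intro exI[of _ W']) auto
    qed
  qed
  moreover have "tw X = g"
    by (rule extensionalityI[where A = X])
      (use base_C CX carrierD(2)[OF g] in \<open>auto simp: tw_def\<close>)
  ultimately show ?thesis by simp
qed

section \<open>Reduction of arbitrary elements to powers of \<open>\<phi>\<close> and swaps\<close>

lemma cyc_bounded:
  assumes g: "loc g"
  obtains M where "\<And>x. x \<in> X \<Longrightarrow> \<bar>cyc g x\<bar> \<le> M"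
proof -
  have "\<exists>M. \<forall>x\<in>X. \<bar>cyc g x\<bar> \<le> M"
    using clopen_X
  proof (induction rule: clopen_induct)
    case (union U V)
    then obtain M N where "\<forall>x\<in>U. \<bar>cyc g x\<bar> \<le> M" "\<forall>x\<in>V. \<bar>cyc g x\<bar> \<le> N" by blast
    then show ?case by (intro exI[of _ "max M N"]) (auto simp: le_max_iff_disj)
  next
    case (local x)
    obtain W where W: "clopen W" "x \<in> W" "\<And>y. y \<in> W \<Longrightarrow> cyc g y = cyc g x"
      using loc_cyc_const[OF g local] by blast
    have "\<exists>M. \<forall>x\<in>U. \<bar>cyc g x\<bar> \<le> M" if "U \<subseteq> W" for U
    proof (intro exI ballI)
      fix y assume "y \<in> U"
      then have "cyc g y = cyc g x" using W(3) that by blast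
      then show "\<bar>cyc g y\<bar> \<le> \<bar>cyc g x\<bar>" by simp
    qed
    then show ?case using W(1,2) by blast
  qed simp
  then show ?thesis using that by blast
qed

definition power :: "int \<Rightarrow> 'a \<Rightarrow> 'a" where "power k = restrict (act k) X"

lemma power_apply [simp]: "x \<in> X \<Longrightarrow> power k x = act k x"
  by (simp add: power_def)

lemma power_carrier [simp]: "power k \<in> carrier G"
proof (rule carrierI)
  show "bij_betw (power k) X X"
    by (rule bij_betw_byWitness[where f' = "power (- k)"]) auto
  show "loc (power k)" unfolding loc_def
    by (intro ballI exI[of _ X] exI[of _ k]) auto
qed (simp add: power_def)

lemma power_inv: "inv\<^bsub>G\<^esub> (power k) = power (- k)"
  by (rule full.inv_equality) (auto intro: G_eqI)

text \<open>Near a small clopen set \<open>C\<close>, \<open>g\<close> acts on the orbit of every point of \<open>C\<close> by one and the same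
  bijection \<open>q\<close> of the integers, up to a bounded range. The image of the past under \<open>q\<close> differs from
  the past by finitely many levels: a permutation \<open>p\<close> of finitely many levels turns it into
  \<open>{..<k}\<close>, and the shift by \<open>- k\<close> then restores the past.\<close>

lemma generated_by_swap_group_and_power:
  assumes g: "g \<in> carrier G"
  obtains s t k where "s \<in> swap_group" "t \<in> swap_group" "g = s \<otimes>\<^bsub>G\<^esub> power k \<otimes>\<^bsub>G\<^esub> t"
proof -
  have swap_group_G: "swap_group \<subseteq> carrier G" using swap_group_subgroup by (rule subgroup.subset)
  have lg: "loc g" using carrierD g by auto
  obtain M where M: "\<And>x. x \<in> X \<Longrightarrow> \<bar>cyc g x\<bar> \<le> M" "M \<ge> 1"
  proof -
    obtain M where "\<And>x. x \<in> X \<Longrightarrow> \<bar>cyc g x\<bar> \<le> M" using cyc_bounded[OF lg] by blast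
    then show ?thesis using that[of "max M 1"] by (simp add: le_max_iff_disj)
  qed
  obtain x where x: "x \<in> X" using X_ne by blast
  \<comment> \<open>Labels move by at most \<open>M\<close>: a target \<open>j \<ge> M\<close> has
    its source at or above 0, and \<open>j < - M\<close> has it below 0. Only targets in the
    half-open \<open>F\<close> can cross the cut.\<close>
  define F where "F = {- M..<M}"
  \<comment> \<open>Large enough to contain every source of a target in \<open>F\<close>, and to
    force visits to \<open>C\<close> so far apart that permuting levels in \<open>F\<close> near one
    does not disturb the cut at another.\<close>
  define F' where "F' = {- 4 * M..4 * M}"
  obtain C where C: "clopen C" "x \<in> C" "sep F' C"
    "\<And>i y. i \<in> F' \<Longrightarrow> y \<in> C \<Longrightarrow> cyc g (act i y) = cyc g (act i x)"
    using cyc_nbhd[OF lg x, of F'] by (metis F'_def finite_atLeastAtMost_int)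
  have CX: "C \<subseteq> X" using C clopen_subset by auto
  have FF': "F \<subseteq> F'" using M(2) by (auto simp: F_def F'_def)
  have s: "sep F C" using sep_mono[OF C(3) FF' order_refl] .
  have finF: "finite F" by (simp add: F_def)
  define q where "q i = i + cyc g (act i x)" for i
  have q_inj: "inj q" unfolding q_def using cyc_shift_inj[OF g x] .
  \<comment> \<open>The levels in the window that the past occupies after applying \<open>q\<close>;
    \<open>k\<close> is chosen so that \<open>{- M..<k}\<close> has equally many.\<close>
  define E where "E = q ` {..<0} \<inter> F"
  define k where "k = int (card E) - M"
  have cE: "card E \<le> card F" using card_mono[OF finF, of E] by (auto simp: E_def)
  have k: "- M \<le> k" "k \<le> M" using cE M(2) by (auto simp: k_def F_def)
  have "card E = card {- M..<k}" using M(2) by (simp add: k_def)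
  then obtain p where p: "p permutes F" "\<And>j. j \<in> F \<Longrightarrow> p j \<in> {- M..<k} \<longleftrightarrow> j \<in> E"
    using permutation_between[OF finF, of E "{- M..<k}"] k by (auto simp: E_def F_def)
  have pF: "p j \<in> F" if "j \<in> F" for j using that p(1) by (simp add: permutes_in_image)
  have pk: "p j < k \<longleftrightarrow> j \<in> E" if "j \<in> F" for j using p(2)[OF that] pF[OF that] by (auto simp: F_def)
  define s where "s = lev C p"
  have sS: "s \<in> swap_group" unfolding s_def by (rule lev_swap_group[OF \<open>sep F C\<close> C(1) finF p(1)])
  then have sG: "s \<in> carrier G" using swap_group_G by auto
  have s_level: "s (act j c) = act (p j) c" if "c \<in> C" "j \<in> F" for c j
    unfolding s_def using lev_level[OF \<open>sep F C\<close> CX p(1) that(2,1)] .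
  \<comment> \<open>Outside the window around \<open>c\<close>, the map \<open>s\<close> may still
    act, through the window around another visit \<open>u\<close> to \<open>C\<close>.\<close>
  have s_far: "\<exists>j'. s (act j c) = act j' c \<and> (j < 0 \<longleftrightarrow> j' < k)" if c: "c \<in> C" and j: "j \<notin> F" for c j
  proof -
    have cX: "c \<in> X" using c CX by auto
    then have "act j c \<in> X" by simp
    then show ?thesis
    proof (cases rule: level_cases[where F = F and U = C])
      case (1 l u)
      have uX: "u \<in> X" using 1 CX by auto
      have u: "u = act (j - l) c"
      proof -
        have "act (- l) (act l u) = act (- l) (act j c)" using 1 by simp
        then show ?thesis using uX cX by simp
      qed
      have "j - l \<noteq> 0" using 1 j by auto
      have "j - l \<notin> F'"
      \<comment> \<open>By separation of \<open>F'\<close>, the visits \<open>c\<close> and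
        \<open>u\<close> are more than \<open>4 * M\<close> apart, so both \<open>j\<close> and its
        image lie on the same side of the cut, whether that is 0 or \<open>k\<close>.\<close>
      proof
        assume a: "j - l \<in> F'"
        have "act 0 u = act (j - l) c" using u by simp
        then have "0 = j - l" using sepD(1)[OF C(3) CX _ a 1(2) c] M(2) by (simp add: F'_def)
        then show False using \<open>j - l \<noteq> 0\<close> by simp
      qed
      moreover have "s (act j c) = act (p l + (j - l)) c"
      proof -
        have "s (act j c) = act (p l) u" unfolding 1(3) by (rule s_level[OF 1(2,1)])
        also have "\<dots> = act (p l + (j - l)) c" using cX by (subst u) (rule act_act)
        finally show ?thesis .
      qed
      moreover have "p l \<in> F" using pF 1(1) .
      ultimately show ?thesis using 1(1) k M(2) j
        by (intro exI[of _ "p l + (j - l)"]) (auto simp: F_def F'_def)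
    next
      case 2
      have "s (act j c) = act j c" unfolding s_def using lev_off[OF p(1) act_in[OF cX] 2] by simp
      then show ?thesis using j k M(2) by (intro exI[of _ j]) (auto simp: F_def)
    qed
  qed
  define t where "t = power (- k) \<otimes>\<^bsub>G\<^esub> (s \<otimes>\<^bsub>G\<^esub> g)"
  have tG: "t \<in> carrier G" using sG g by (simp add: t_def)
  have "t \<in> swap_group"
  proof (rule segment_preserving_swap_group[OF tG C(1)])
    show "C \<noteq> {}" using C by auto
    fix c i assume c: "c \<in> C"
    have cX: "c \<in> X" using c CX by auto
    define j where "j = i + cyc g (act i c)"
    have gj: "g (act i c) = act j c"
      using loc_cyc[OF lg, of "act i c"] cX by (simp add: j_def add.commute)
    have d: "\<bar>j - i\<bar> \<le> M" using M(1)[of "act i c"] cX by (simp add: j_def)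
    have "\<exists>j'. s (act j c) = act j' c \<and> (i < 0 \<longleftrightarrow> j' < k)"
    proof (cases "j \<in> F")
      case True
      then have "i \<in> F'" using d M(2) by (auto simp: F_def F'_def)
      \<comment> \<open>On \<open>F'\<close> the cocycle along the orbit of \<open>c\<close> equals
        the one along \<open>x\<close>; therefore a single \<open>p\<close> serves all points of
        \<open>C\<close>.\<close>
      then have "j = q i" using C(4)[OF _ c] by (simp add: j_def q_def)
      then have "j \<in> E \<longleftrightarrow> i < 0" using True q_inj by (auto simp: E_def inj_eq inj_image_mem_iff)
      then show ?thesis using s_level[OF c True] pk[OF True] by blast
    next
      case False
      then have "j < 0 \<longleftrightarrow> i < 0" using d M(2) by (auto simp: F_def)
      then show ?thesis using s_far[OF c False] by blast
    qed
    then obtain j' where j': "s (act j c) = act j' c" "i < 0 \<longleftrightarrow> j' < k" by blast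
    have "t (act i c) = act (j' - k) c"
      using sG g cX gj j' by (simp add: t_def)
    also have "\<dots> = act (j' - k - i) (act i c)" using cX by simp
    finally have "cyc t (act i c) = j' - k - i" using cX by (intro cyc_eqI) auto
    then show "i < 0 \<longleftrightarrow> i + cyc t (act i c) < 0" using j'(2) by simp
  qed
  moreover have "inv\<^bsub>G\<^esub> s \<in> swap_group" using subgroup.m_inv_closed[OF swap_group_subgroup sS] .
  moreover have "g = inv\<^bsub>G\<^esub> s \<otimes>\<^bsub>G\<^esub> power k \<otimes>\<^bsub>G\<^esub> t"
    unfolding t_def power_inv[symmetric] using sG g by (simp add: full.word_simps)
  ultimately show ?thesis using that by blast
qed

text \<open>Centrality modulo \<open>Alt\<close> is bootstrapped. Swaps are central and powers
  commute with each other, so everything commutes with the powers; hence the powers are central too,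
  and swaps and powers together generate \<open>G\<close>.\<close>

lemma commutator_in_Alt:
  assumes g: "g \<in> carrier G" and h: "h \<in> carrier G"
  shows "g \<otimes>\<^bsub>G\<^esub> h \<otimes>\<^bsub>G\<^esub> inv\<^bsub>G\<^esub> g \<otimes>\<^bsub>G\<^esub> inv\<^bsub>G\<^esub> h \<in> Alt"
proof -
  let ?Z = "\<lambda>M. {s \<in> carrier G. \<forall>g\<in>M. g \<otimes>\<^bsub>G\<^esub> s \<otimes>\<^bsub>G\<^esub> inv\<^bsub>G\<^esub> g \<otimes>\<^bsub>G\<^esub> inv\<^bsub>G\<^esub> s \<in> Alt}"
  have Z: "subgroup (?Z M) G" if "M \<subseteq> carrier G" for M
    by (rule full.central_mod_subgroup[OF Alt_normal that])
  have swap_group_Z: "swap_group \<subseteq> ?Z (carrier G)"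
    unfolding swap_group_def
    by (rule full.generate_subgroup_incl[OF _ Z[OF order_refl]]) (use swaps_central in blast)
  have all: "carrier G \<subseteq> K" if K: "subgroup K G" "swap_group \<subseteq> K" "range power \<subseteq> K" for K
  proof
    fix f assume "f \<in> carrier G"
    then obtain s t k where "s \<in> swap_group" "t \<in> swap_group" "f = s \<otimes>\<^bsub>G\<^esub> power k \<otimes>\<^bsub>G\<^esub> t"
      using generated_by_swap_group_and_power by blast
    then show "f \<in> K" using K(2,3) by (auto intro!: subgroup.m_closed[OF K(1)])
  qed
  have pp: "power k \<otimes>\<^bsub>G\<^esub> power l \<otimes>\<^bsub>G\<^esub> inv\<^bsub>G\<^esub> (power k) \<otimes>\<^bsub>G\<^esub> inv\<^bsub>G\<^esub> (power l) = \<one>\<^bsub>G\<^esub>" for k l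
    unfolding power_inv by (rule G_eqI) auto
  have rp: "range power \<subseteq> carrier G" by auto
  have "carrier G \<subseteq> ?Z (range power)"
  proof (rule all[OF Z[OF rp]])
    show "swap_group \<subseteq> ?Z (range power)" using swap_group_Z rp by blast
    show "range power \<subseteq> ?Z (range power)"
      using subgroup.one_closed[OF Alt_subgroup] by (auto simp: pp)
  qed
  then have pg: "power k \<otimes>\<^bsub>G\<^esub> f \<otimes>\<^bsub>G\<^esub> inv\<^bsub>G\<^esub> (power k) \<otimes>\<^bsub>G\<^esub> inv\<^bsub>G\<^esub> f \<in> Alt" if "f \<in> carrier G" for k f
    using that by blast
  \<comment> \<open>Inverting a commutator exchanges its two entries.\<close>
  have "f \<otimes>\<^bsub>G\<^esub> power k \<otimes>\<^bsub>G\<^esub> inv\<^bsub>G\<^esub> f \<otimes>\<^bsub>G\<^esub> inv\<^bsub>G\<^esub> (power k) \<in> Alt" if f: "f \<in> carrier G" for k f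
    using subgroup.m_inv_closed[OF Alt_subgroup pg[OF f, of k]] f by (simp add: full.word_simps)
  then have "carrier G \<subseteq> ?Z (carrier G)"
    by (intro all[OF Z[OF order_refl]] swap_group_Z) auto
  then show ?thesis using g h by blast
qed

lemma derived_eq_Alt:
  assumes H: "subgroup H G" and th: "three_cycles \<subseteq> H"
  shows "derived G H = Alt"
proof
  have "derived_set G H \<subseteq> Alt" using subgroup.subset[OF H] commutator_in_Alt by blast
  then show "derived G H \<subseteq> Alt"
    unfolding derived_def by (rule full.generate_subgroup_incl[OF _ Alt_subgroup])
qed (rule Alt_subset_derived[OF H th])

end

subsection \<open>Invariant measures and the index map\<close>

text \<open>Needed for a product with uncountably many factors, where compactness need not give
  convergent subsequences. A filter finer than \<open>sequentially\<close> takes their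
  place.\<close>

lemma cluster_point_limit:
  fixes a :: "nat \<Rightarrow> 'b::topological_space"
  assumes "compact S" "\<And>n. a n \<in> S"
  obtains m F where "m \<in> S" "F \<noteq> bot" "F \<le> sequentially" "(a \<longlongrightarrow> m) F"
proof -
  obtain m where m: "m \<in> S" "inf (nhds m) (filtermap a sequentially) \<noteq> bot"
  proof -
    have "filtermap a sequentially \<noteq> bot" by (simp add: filtermap_bot_iff)
    moreover have "eventually (\<lambda>x. x \<in> S) (filtermap a sequentially)"
      by (simp add: eventually_filtermap assms(2))
    ultimately show ?thesis using assms(1) that unfolding compact_filter by blast
  qed
  \<comment> \<open>Late indices \<open>n\<close> with \<open>a n\<close> close to \<open>m\<close>;
    the filter is proper because \<open>m\<close> is a cluster point.\<close>
  define F where "F = inf sequentially (filtercomap a (nhds m))"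
  have "F \<noteq> bot"
  proof
    assume "F = bot"
    then have "eventually (\<lambda>_. False) F" by simp
    then obtain P Q where PQ: "eventually P sequentially" "eventually Q (filtercomap a (nhds m))"
      "\<And>n. P n \<Longrightarrow> Q n \<Longrightarrow> False"
      unfolding F_def eventually_inf by blast
    obtain R where R: "eventually R (nhds m)" "\<And>n. R (a n) \<Longrightarrow> Q n"
      using PQ(2) unfolding eventually_filtercomap by blast
    have "eventually (\<lambda>y. \<not> R y) (filtermap a sequentially)"
      unfolding eventually_filtermap using PQ(1) by (rule eventually_mono) (use PQ(3) R(2) in blast)
    then have "eventually (\<lambda>_. False) (inf (nhds m) (filtermap a sequentially))"
      unfolding eventually_inf using R(1) by blast
    then show False using m(2) by (simp add: eventually_False)
  qed
  moreover have "(a \<longlongrightarrow> m) F"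
    unfolding F_def using filterlim_filtercomap[of a "nhds m"] by (rule filterlim_mono) auto
  ultimately show ?thesis using that[OF m(1)] by (simp add: F_def)
qed

context cantor_minimal
begin

text \<open>The Krylov-Bogolyubov argument on sets: \<open>m\<close> is a limit of visit frequencies
  along one orbit, taken in the compact product of unit intervals over all subsets.\<close>

lemma invariant_mean:
  obtains m :: "'a set \<Rightarrow> real" where "\<And>U. 0 \<le> m U" "m X = 1"
    "\<And>U V. U \<inter> V = {} \<Longrightarrow> m (U \<union> V) = m U + m V"
    "\<And>U. m (pre 1 U) = m U"
proof -
  obtain x where x: "x \<in> X" using X_ne by blast
  define a :: "nat \<Rightarrow> 'a set \<Rightarrow> real" where
    "a n U = (\<Sum>k<Suc n. indicat_real U (act (int k) x)) / Suc n" for n U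
  have a01: "0 \<le> a n U" "a n U \<le> 1" for n U
  proof -
    have "(\<Sum>k<Suc n. indicat_real U (act (int k) x)) \<le> (\<Sum>k<Suc n. 1)"
      by (rule sum_mono) (simp add: indicator_def)
    then show "a n U \<le> 1" by (simp add: a_def)
    show "0 \<le> a n U" unfolding a_def by (intro divide_nonneg_nonneg sum_nonneg) (auto simp: indicator_def)
  qed
  have "compact (PiE UNIV (\<lambda>_::'a set. {0..1::real}))"
    using compactin_PiE[of "\<lambda>_::'a set. euclidean :: real topology" UNIV "\<lambda>_. {0..1}"]
    by (simp add: euclidean_product_topology compactin_euclidean_iff)
  then obtain m F where m: "m \<in> PiE UNIV (\<lambda>_::'a set. {0..1::real})" and F: "F \<noteq> bot" "F \<le> sequentially"
      "(a \<longlongrightarrow> m) F"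
    by (rule cluster_point_limit[where a = a]) (use a01 in auto)
  have lim: "((\<lambda>n. a n U) \<longlongrightarrow> m U) F" for U
  proof (rule topological_tendstoI)
    fix A :: "real set" assume A: "open A" "m U \<in> A"
    have "open ((\<lambda>f. f U) -` A \<inter> (UNIV :: ('a set \<Rightarrow> real) set))"
      using continuous_on_open_vimage[OF open_UNIV, of "\<lambda>f :: 'a set \<Rightarrow> real. f U"]
        continuous_on_product_coordinates[of U] A(1) by (simp add: vimage_def continuous_on_subset)
    then have "\<forall>\<^sub>F n in F. a n \<in> (\<lambda>f. f U) -` A \<inter> UNIV"
      by (rule topological_tendstoD[OF F(3)]) (use A(2) in simp)
    then show "\<forall>\<^sub>F n in F. a n U \<in> A" by simp
  qed
  show ?thesis
  proof (rule that)
    show "0 \<le> m U" for U using m by auto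
    have "a n X = 1" for n
    proof -
      have "(\<Sum>k<Suc n. indicat_real X (act (int k) x)) = (\<Sum>k<Suc n. 1)"
        using x by (intro sum.cong) auto
      then show ?thesis by (simp add: a_def)
    qed
    then have "((\<lambda>_. 1) \<longlongrightarrow> m X) F" using lim[of X] by simp
    then show "m X = 1" using tendsto_unique[OF F(1) _ tendsto_const] by blast
    show "m (U \<union> V) = m U + m V" if d: "U \<inter> V = {}" for U V
    proof -
      have "a n (U \<union> V) = a n U + a n V" for n
        unfolding a_def using d
        by (simp add: indicator_add[symmetric] sum.distrib add_divide_distrib del: sum.lessThan_Suc)
      then have "((\<lambda>n. a n U + a n V) \<longlongrightarrow> m (U \<union> V)) F" using lim[of "U \<union> V"] by simp
      then show ?thesis using tendsto_unique[OF F(1) _ tendsto_add[OF lim lim]] by blast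
    qed
    show "m (pre 1 U) = m U" for U
    proof -
      let ?f = "\<lambda>k. indicat_real U (act (int k) x)"
      \<comment> \<open>Shifting the orbit by one step leaves only the two boundary terms of a
        telescoping sum.\<close>
      have "a n (pre 1 U) - a n U = (?f (Suc n) - ?f 0) / Suc n" for n
      proof -
        have "(\<Sum>k<Suc n. indicat_real (pre 1 U) (act (int k) x)) = (\<Sum>k<Suc n. ?f (Suc k))"
          using x by (intro sum.cong) (auto simp: indicator_def add.commute)
        then have "a n (pre 1 U) - a n U = (\<Sum>k<Suc n. ?f (Suc k) - ?f k) / Suc n"
          unfolding a_def by (simp only: sum_subtractf diff_divide_distrib)
        then show ?thesis by (simp only: sum_lessThan_telescope[of ?f "Suc n"])
      qed
      moreover have "(\<lambda>n. (?f (Suc n) - ?f 0) / Suc n) \<longlonglongrightarrow> 0"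
      proof (rule Lim_null_comparison)
        show "\<forall>\<^sub>F n in sequentially. norm ((?f (Suc n) - ?f 0) / Suc n) \<le> 1 / Suc n"
          by (intro always_eventually allI) (auto simp: indicator_def divide_simps)
        show "(\<lambda>n. 1 / real (Suc n)) \<longlonglongrightarrow> 0" using LIMSEQ_Suc[OF lim_1_over_n] by simp
      qed
      ultimately have "(\<lambda>n. a n (pre 1 U) - a n U) \<longlonglongrightarrow> 0" by simp
      then have "((\<lambda>n. a n (pre 1 U) - a n U) \<longlongrightarrow> 0) F" using F(2) by (rule tendsto_mono[rotated])
      then have "m (pre 1 U) - m U = 0" using tendsto_unique[OF F(1) tendsto_diff[OF lim lim]] by blast
      then show ?thesis by simp
    qed
  qed
qed

section \<open>From the finitely additive mean to an invariant Borel measure\<close>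

lemma closed_clopen_open:
  assumes F: "closedin T F" and U: "openin T U" "F \<subseteq> U"
  obtains V where "clopen V" "F \<subseteq> V" "V \<subseteq> U"
proof -
  have "\<exists>V. clopen V \<and> X \<inter> F \<subseteq> V \<and> V \<subseteq> U"
    using clopen_X
  proof (induction rule: clopen_induct)
    case empty then show ?case by (intro exI[of _ "{}"]) simp
  next
    case (union A B)
    then obtain V V' where "clopen V" "A \<inter> F \<subseteq> V" "V \<subseteq> U" "clopen V'" "B \<inter> F \<subseteq> V'" "V' \<subseteq> U" by blast
    then show ?case by (intro exI[of _ "V \<union> V'"]) (auto intro: clopen_Un)
  next
    case (local x)
    show ?case
    proof (cases "x \<in> F")
      case True
      then obtain W where "clopen W" "x \<in> W" "W \<subseteq> U" using clopen_basis[OF U(1)] U(2) by blast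
      then show ?thesis by (intro exI[of _ W]) auto
    next
      case False
      then obtain W where "clopen W" "x \<in> W" "W \<subseteq> X - F" using clopen_basis[of "X - F" x] F local by blast
      then show ?thesis by (intro exI[of _ W] conjI allI impI exI[of _ "{}"]) auto
    qed
  qed
  then show ?thesis using that closedin_subset[OF F] by blast
qed

text \<open>In a metrizable space an open set is a countable union of closed sets, and between each
  of these and the open set lies a clopen set.\<close>

lemma sigma_sets_clopen: "sigma_sets X {U. openin T U} = sigma_sets X {U. clopen U}"
proof
  show "sigma_sets X {U. clopen U} \<subseteq> sigma_sets X {U. openin T U}"
    by (rule sigma_sets_mono') (auto simp: clopen_def)
  show "sigma_sets X {U. openin T U} \<subseteq> sigma_sets X {U. clopen U}"
  proof (rule sigma_sets_mono, rule subsetI)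
    fix U assume "U \<in> {U. openin T U}"
    then have U: "openin T U" by simp
    then have "fsigma_in T U" using metrizable open_imp_fsigma_in by blast
    then obtain \<F> where F: "countable \<F>" "\<F> \<subseteq> Collect (closedin T)" "\<Union>\<F> = U"
      unfolding fsigma_in_def union_of_def by blast
    have "\<forall>F\<in>\<F>. \<exists>V. clopen V \<and> F \<subseteq> V \<and> V \<subseteq> U"
      using closed_clopen_open[OF _ U] F by (metis Ball_Collect Sup_upper)
    then obtain V where V: "\<And>F. F \<in> \<F> \<Longrightarrow> clopen (V F) \<and> F \<subseteq> V F \<and> V F \<subseteq> U" by metis
    have "U = (\<Union>F\<in>\<F>. V F)" using V F(3) by blast
    also have "\<dots> \<in> sigma_sets X {U. clopen U}"
      by (rule sigma_sets_UNION) (use F(1) V in auto)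
    finally show "U \<in> sigma_sets X {U. clopen U}" .
  qed
qed

lemma clopen_Pow: "{U. clopen U} \<subseteq> Pow X"
  using clopen_subset by auto

lemma open_Pow: "{U. openin T U} \<subseteq> Pow X"
  using openin_subset by auto

lemma act_measurable:
  assumes "sets \<mu> = sigma_sets X {U. openin T U}"
  shows "act k \<in> measurable \<mu> \<mu>"
proof -
  have sp: "space \<mu> = X"
    using sets_eq_imp_space_eq[of \<mu> "sigma X {U. openin T U}"] assms open_Pow by simp
  show ?thesis
  proof (rule measurable_sigma_sets[OF assms open_Pow])
    fix U assume "U \<in> {U. openin T U}"
    then have "openin T (pre k U)" using openin_pre by simp
    moreover have "act k -` U \<inter> space \<mu> = pre k U" by (auto simp: sp)
    ultimately show "act k -` U \<inter> space \<mu> \<in> sets \<mu>" using assms by auto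
  qed (simp add: sp)
qed

text \<open>Caratheodory extension of the mean from the ring of clopen sets, which generates the
  Borel sets.\<close>

lemma invariant_prob_measure_exists: "\<exists>\<mu>. invariant_prob_measure T \<phi> \<mu>"
proof -
  obtain m :: "'a set \<Rightarrow> real" where m: "\<And>U. 0 \<le> m U" "m X = 1"
    "\<And>U V. U \<inter> V = {} \<Longrightarrow> m (U \<union> V) = m U + m V" "\<And>U. m (pre 1 U) = m U"
    using invariant_mean by blast
  have m0: "m {} = 0" using m(3)[of "{}" "{}"] by simp
  let ?C = "{U. clopen U}"
  interpret ring_of_sets X ?C
    by (rule ring_of_setsI) (auto intro: clopen_Un clopen_Diff dest: clopen_subset)
  have "\<exists>\<mu>. (\<forall>U\<in>?C. \<mu> U = ennreal (m U)) \<and> measure_space X (sigma_sets X ?C) \<mu>"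
  proof (rule caratheodory_empty_continuous)
    show "positive ?C (\<lambda>U. ennreal (m U))" by (simp add: positive_def m0)
    show "additive ?C (\<lambda>U. ennreal (m U))" using m by (auto simp: additive_def ennreal_plus)
    \<comment> \<open>By compactness, decreasing clopen sets with empty intersection are eventually
      empty, so continuity at the empty set is automatic.\<close>
    fix A :: "nat \<Rightarrow> 'a set" assume A: "range A \<subseteq> ?C" "decseq A" "(\<Inter>i. A i) = {}"
    obtain J where J: "finite J" "X \<subseteq> (\<Union>i\<in>J. X - A i)"
    proof (rule compact_cover[of UNIV "\<lambda>i. X - A i"])
      show "openin T (X - A i)" for i using A(1) clopenD(2) by blast
      show "X \<subseteq> (\<Union>i\<in>UNIV. X - A i)" using A(3) by blast
    qed (use that in blast)
    obtain N where N: "\<And>i. i \<in> J \<Longrightarrow> i \<le> N" using J(1) unfolding finite_nat_set_iff_bounded_le by auto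
    have "A n = {}" if "n \<ge> N" for n
    proof -
      have "A n \<subseteq> A i" if "i \<in> J" for i
        using decseqD[OF A(2) order_trans[OF N[OF that] \<open>n \<ge> N\<close>]] .
      then show ?thesis using J(2) A(1) clopen_subset by blast
    qed
    then have "eventually (\<lambda>i. ennreal (m (A i)) = 0) sequentially"
      unfolding eventually_sequentially using m0 by (intro exI[of _ N]) simp
    then show "(\<lambda>i. ennreal (m (A i))) \<longlonglongrightarrow> 0" by (rule tendsto_eventually)
  qed simp
  then obtain \<mu>0 where mu0: "\<And>U. clopen U \<Longrightarrow> \<mu>0 U = ennreal (m U)" "measure_space X (sigma_sets X ?C) \<mu>0"
    by auto
  define \<mu> where "\<mu> = measure_of X (sigma_sets X ?C) \<mu>0"
  have sa: "sigma_algebra X (sigma_sets X ?C)" using mu0(2) by (simp add: measure_space_def)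
  have em: "emeasure \<mu> A = \<mu>0 A" if "A \<in> sigma_sets X ?C" for A
    unfolding \<mu>_def using mu0(2) that by (intro emeasure_measure_of_sigma) (auto simp: measure_space_def)
  have sets: "sets \<mu> = sigma_sets X ?C"
    unfolding \<mu>_def using sa by (simp add: sigma_algebra.sets_measure_of_eq)
  have emc: "emeasure \<mu> U = ennreal (m U)" if "clopen U" for U
    using em[of U] mu0(1)[OF that] that by auto
  have sets': "sets \<mu> = sigma_sets X {U. openin T U}" using sets sigma_sets_clopen by simp
  have sp: "space \<mu> = X"
    using sets_eq_imp_space_eq[of \<mu> "sigma X {U. openin T U}"] sets' open_Pow by simp
  have "prob_space \<mu>" by (rule prob_spaceI) (simp add: sp emc m)
  moreover have "sets \<mu> = sets (sigma X {U. openin T U})" using sets' open_Pow by simp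
  moreover have "distr \<mu> \<mu> \<phi> = \<mu>"
  \<comment> \<open>Clopen sets form an intersection-stable generator, so invariance of the mean on
    them suffices.\<close>
  proof (rule measure_eqI_generator_eq[where E = ?C and \<Omega> = X and A = "\<lambda>_. X"])
    show "Int_stable ?C" by (auto simp: Int_stable_def intro: clopen_Int)
    fix U assume "U \<in> ?C"
    then have U: "clopen U" by simp
    have "\<phi> \<in> measurable \<mu> \<mu>" using act_measurable[OF sets', of 1] by (simp add: act_1 cong: measurable_cong)
    moreover have "\<phi> -` U \<inter> space \<mu> = pre 1 U" by (auto simp: sp act_1)
    ultimately have "emeasure (distr \<mu> \<mu> \<phi>) U = emeasure \<mu> (pre 1 U)"
      using U sets by (subst emeasure_distr) auto
    then show "emeasure (distr \<mu> \<mu> \<phi>) U = emeasure \<mu> U"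
      using emc[OF U] emc[OF clopen_pre[OF U]] m(4) by simp
  next
    show "emeasure (distr \<mu> \<mu> \<phi>) X \<noteq> \<infinity>"
    proof -
      have "\<phi> \<in> measurable \<mu> \<mu>" using act_measurable[OF sets', of 1] by (simp add: act_1 cong: measurable_cong)
      then have "emeasure (distr \<mu> \<mu> \<phi>) X = emeasure \<mu> (pre 1 X)"
        using sets by (subst emeasure_distr) (auto simp: sp act_1 intro!: arg_cong[where f = "emeasure \<mu>"])
      then show ?thesis using emc[OF clopen_pre[OF clopen_X]] by simp
    qed
  qed (use clopen_Pow sets in auto)
  ultimately have "invariant_prob_measure T \<phi> \<mu>" by (simp add: invariant_prob_measure_def)
  then show ?thesis by blast
qed

text \<open>The same choice as inside \<open>index_map\<close>.\<close>

definition \<mu> :: "'a measure" where "\<mu> = (SOME \<mu>. invariant_prob_measure T \<phi> \<mu>)"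

lemma invariant_mu: "invariant_prob_measure T \<phi> \<mu>"
  unfolding \<mu>_def using invariant_prob_measure_exists by (rule someI_ex)

lemma prob_space_mu: "prob_space \<mu>" and sets_mu: "sets \<mu> = sigma_sets X {U. openin T U}"
  and distr_mu: "distr \<mu> \<mu> \<phi> = \<mu>"
  using invariant_mu open_Pow by (auto simp: invariant_prob_measure_def)

lemma space_mu: "space \<mu> = X"
  using sets_eq_imp_space_eq[of \<mu> "sigma X {U. openin T U}"] sets_mu open_Pow by simp

lemma open_sets_mu: "openin T U \<Longrightarrow> U \<in> sets \<mu>"
  by (simp add: sets_mu sigma_sets.Basic)

lemma pre_sets_mu: "A \<in> sets \<mu> \<Longrightarrow> pre k A \<in> sets \<mu>"
  using measurable_sets[OF act_measurable[OF sets_mu, of k], of A]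
  by (simp add: space_mu pre_def vimage_def Int_def conj_commute)

lemma emeasure_pre: "A \<in> sets \<mu> \<Longrightarrow> emeasure \<mu> (pre k A) = emeasure \<mu> A"
proof (induction k arbitrary: A rule: int_induct[where k = 0])
  case base
  then show ?case using sets.sets_into_space[of A \<mu>] by (auto simp: pre_def space_mu intro!: arg_cong[where f = "emeasure \<mu>"])
next
  have one: "emeasure \<mu> (pre 1 A) = emeasure \<mu> A" if A: "A \<in> sets \<mu>" for A
  proof -
    have "\<phi> \<in> measurable \<mu> \<mu>"
      using act_measurable[OF sets_mu, of 1] by (simp add: act_1 cong: measurable_cong)
    then have "emeasure (distr \<mu> \<mu> \<phi>) A = emeasure \<mu> (\<phi> -` A \<inter> space \<mu>)" using A by (rule emeasure_distr)
    moreover have "\<phi> -` A \<inter> space \<mu> = pre 1 A" by (auto simp: space_mu act_1)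
    ultimately show ?thesis using distr_mu by simp
  qed
  {
    case (step1 k)
    have "pre (k + 1) A = pre k (pre 1 A)" by (auto simp: add.commute)
    then show ?case using step1 one pre_sets_mu by simp
  next
    case (step2 k)
    have "pre k A = pre (k - 1) (pre 1 A)" by auto
    have "pre 1 (pre (k - 1) A) = pre k A" by auto
    then show ?case using step2 one[OF pre_sets_mu[OF step2(3), of "k - 1"]] by simp
  }
qed

text \<open>The preimage of \<open>A\<close> is cut by cocycle value into finitely many pieces
  \<open>B k\<close>. Each is moved by a measure-preserving power of \<open>\<phi>\<close>, and
  bijectivity of \<open>g\<close> makes the images a partition of \<open>A\<close>.\<close>

lemma emeasure_vimage:
  assumes g: "g \<in> carrier G" and A: "A \<in> sets \<mu>"
  shows "emeasure \<mu> {x \<in> X. g x \<in> A} = emeasure \<mu> A"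
proof -
  have lg: "loc g" using carrierD g by blast
  obtain M where M: "\<And>x. x \<in> X \<Longrightarrow> \<bar>cyc g x\<bar> \<le> M" using cyc_bounded[OF lg] by blast
  define B where "B k = {x \<in> X. cyc g x \<in> {k}} \<inter> pre k A" for k
  have B: "B k \<in> sets \<mu>" for k
    unfolding B_def using open_sets_mu[OF openin_cyc[OF lg]] pre_sets_mu[OF A] by (rule sets.Int)
  have BX: "B k \<subseteq> X" for k by (auto simp: B_def)
  have gB: "g x = act k x" if "x \<in> B k" for x k
    using that loc_cyc[OF lg, of x] by (auto simp: B_def)
  have AX: "A \<subseteq> X" using sets.sets_into_space[OF A] by (simp add: space_mu)
  let ?K = "{- M..M}"
  have 1: "{x \<in> X. g x \<in> A} = (\<Union>k\<in>?K. B k)"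
  proof (intro equalityI subsetI)
    fix x assume x: "x \<in> {x \<in> X. g x \<in> A}"
    then have "x \<in> B (cyc g x)" "cyc g x \<in> ?K" using loc_cyc[OF lg, of x] M[of x] by (auto simp: B_def)
    then show "x \<in> (\<Union>k\<in>?K. B k)" by blast
  next
    fix x assume "x \<in> (\<Union>k\<in>?K. B k)"
    then obtain k where k: "x \<in> B k" by blast
    then have "x \<in> X" "act k x \<in> A" by (auto simp: B_def)
    then show "x \<in> {x \<in> X. g x \<in> A}" using gB[OF k] by simp
  qed
  have 2: "A = (\<Union>k\<in>?K. act k ` B k)"
  proof (intro equalityI subsetI)
    fix y assume y: "y \<in> A"
    define x where "x = (inv\<^bsub>G\<^esub> g) y"
    have x: "x \<in> X" "g x = y" using y AX g by (auto simp: x_def)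
    then have "x \<in> {x \<in> X. g x \<in> A}" using y by simp
    then obtain k where "k \<in> ?K" "x \<in> B k" unfolding 1 by blast
    then show "y \<in> (\<Union>k\<in>?K. act k ` B k)" using gB x(2) by blast
  next
    fix y assume "y \<in> (\<Union>k\<in>?K. act k ` B k)"
    then show "y \<in> A" by (auto simp: B_def)
  qed
  have d1: "disjoint_family_on B ?K" by (auto simp: disjoint_family_on_def B_def)
  have d2: "disjoint_family_on (\<lambda>k. act k ` B k) ?K"
    unfolding disjoint_family_on_def
  proof (intro ballI impI)
    fix k l :: int assume kl: "k \<noteq> l"
    show "act k ` B k \<inter> act l ` B l = {}"
    proof (rule ccontr)
      assume "act k ` B k \<inter> act l ` B l \<noteq> {}"
      then obtain x z where xz: "x \<in> B k" "z \<in> B l" "act k x = act l z" by blast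
      then have "g x = g z" using gB by simp
      then have "x = z" using carrierD(4)[OF g] BX xz by (meson inj_onD subset_iff)
      then show False using xz kl by (auto simp: B_def)
    qed
  qed
  have e: "act k ` B k \<in> sets \<mu>" "emeasure \<mu> (act k ` B k) = emeasure \<mu> (B k)" for k
    using pre_sets_mu[OF B] emeasure_pre[OF B] image_act[OF BX] by simp_all
  have "emeasure \<mu> {x \<in> X. g x \<in> A} = (\<Sum>k\<in>?K. emeasure \<mu> (B k))"
    unfolding 1 by (rule sum_emeasure[symmetric]) (use B d1 in auto)
  also have "\<dots> = (\<Sum>k\<in>?K. emeasure \<mu> (act k ` B k))" by (simp add: e)
  also have "\<dots> = emeasure \<mu> (\<Union>k\<in>?K. act k ` B k)"
    by (rule sum_emeasure) (use e d2 in auto)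
  also have "\<dots> = emeasure \<mu> A" by (simp only: 2[symmetric])
  finally show ?thesis .
qed

lemma carrier_measurable:
  assumes g: "g \<in> carrier G"
  shows "g \<in> measurable \<mu> \<mu>"
proof (rule measurable_sigma_sets[OF sets_mu open_Pow])
  fix U assume "U \<in> {U. openin T U}"
  then have "openin T {x \<in> X. g x \<in> U}"
    using loc_continuous[OF carrierD(1)[OF g]] by (simp add: openin_continuous_map_preimage)
  moreover have "g -` U \<inter> space \<mu> = {x \<in> X. g x \<in> U}" by (auto simp: space_mu)
  ultimately show "g -` U \<inter> space \<mu> \<in> sets \<mu>" using open_sets_mu by simp
qed (use carrierD(5)[OF g] in \<open>simp add: space_mu\<close>)

lemma distr_carrier:
  assumes g: "g \<in> carrier G"
  shows "distr \<mu> \<mu> g = \<mu>"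
proof (rule measure_eqI)
  fix A assume "A \<in> sets (distr \<mu> \<mu> g)"
  then have A: "A \<in> sets \<mu>" by simp
  have "g -` A \<inter> space \<mu> = {x \<in> X. g x \<in> A}" by (auto simp: space_mu)
  then show "emeasure (distr \<mu> \<mu> g) A = emeasure \<mu> A"
    using emeasure_distr[OF carrier_measurable[OF g] A] emeasure_vimage[OF g A] by simp
qed simp

lemma cyc_borel:
  assumes g: "loc g"
  shows "(\<lambda>x. real_of_int (cyc g x)) \<in> borel_measurable \<mu>"
proof (rule measurableI)
  fix A :: "real set"
  have "(\<lambda>x. real_of_int (cyc g x)) -` A \<inter> space \<mu> = {x \<in> X. cyc g x \<in> {k. real_of_int k \<in> A}}"
    by (auto simp: space_mu)
  then show "(\<lambda>x. real_of_int (cyc g x)) -` A \<inter> space \<mu> \<in> sets \<mu>"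
    using open_sets_mu[OF openin_cyc[OF g, of "{k. real_of_int k \<in> A}"]] by simp
qed simp

lemma cyc_integrable:
  assumes g: "loc g"
  shows "integrable \<mu> (\<lambda>x. real_of_int (cyc g x))"
proof -
  interpret prob_space \<mu> by (rule prob_space_mu)
  obtain M where M: "\<And>x. x \<in> X \<Longrightarrow> \<bar>cyc g x\<bar> \<le> M" using cyc_bounded[OF g] by blast
  show ?thesis
  proof (rule integrable_const_bound)
    show "AE x in \<mu>. norm (real_of_int (cyc g x)) \<le> real_of_int M"
      by (rule AE_I2) (use M in \<open>simp add: space_mu flip: of_int_abs\<close>)
  qed (rule cyc_borel[OF g])
qed

lemma index_map_cyc:
  assumes g: "g \<in> carrier G"
  shows "index_map T \<phi> g = (LINT x|\<mu>. real_of_int (cyc g x))"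
proof -
  have "orbit_cocycle T \<phi> g (cyc g)" using carrierD(1)[OF g] by (simp add: orbit_cocycle_iff)
  then have "orbit_cocycle T \<phi> g (SOME n. orbit_cocycle T \<phi> g n)"
    using someI[of "orbit_cocycle T \<phi> g"] by blast
  then have "\<forall>x\<in>X. (SOME n. orbit_cocycle T \<phi> g n) x = cyc g x"
    by (blast dest: orbit_cocycle_iff[THEN iffD1])
  then show ?thesis
    unfolding index_map_def Let_def \<mu>_def[symmetric]
    by (intro Bochner_Integration.integral_cong) (auto simp: space_mu)
qed

lemma cyc_mult:
  assumes f: "f \<in> carrier G" and g: "g \<in> carrier G" and x: "x \<in> X"
  shows "cyc (f \<otimes>\<^bsub>G\<^esub> g) x = cyc f (g x) + cyc g x"
proof (rule cyc_eqI[OF x])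
  have gx: "g x = act (cyc g x) x" using loc_cyc[OF carrierD(1)[OF g] x] by simp
  have "f (g x) = act (cyc f (g x)) (g x)" using loc_cyc[OF carrierD(1)[OF f] carrierD(5)[OF g x]] by simp
  also have "\<dots> = act (cyc f (g x)) (act (cyc g x) x)" by (subst (2) gx) (rule refl)
  also have "\<dots> = act (cyc f (g x) + cyc g x) x" using x by simp
  finally show "(f \<otimes>\<^bsub>G\<^esub> g) x = act (cyc f (g x) + cyc g x) x" using f g x by simp
qed

text \<open>Integrates the cocycle identity; the term \<open>cyc f (g x)\<close> has the integral of
  \<open>cyc f\<close> because \<open>g\<close> preserves \<open>\<mu>\<close>.\<close>

lemma index_map_mult:
  assumes f: "f \<in> carrier G" and g: "g \<in> carrier G"
  shows "index_map T \<phi> (f \<otimes>\<^bsub>G\<^esub> g) = index_map T \<phi> f + index_map T \<phi> g"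
proof -
  have lf: "loc f" and lg: "loc g" using f g carrierD by auto
  have mg: "g \<in> measurable \<mu> \<mu>" by (rule carrier_measurable[OF g])
  have i: "integrable \<mu> (\<lambda>x. real_of_int (cyc f (g x)))"
    using integrable_distr[OF mg, of "\<lambda>x. real_of_int (cyc f x)"] cyc_integrable[OF lf] by (simp add: distr_carrier[OF g])
  have "index_map T \<phi> (f \<otimes>\<^bsub>G\<^esub> g) = (LINT x|\<mu>. real_of_int (cyc (f \<otimes>\<^bsub>G\<^esub> g) x))"
    using f g by (intro index_map_cyc) simp
  also have "\<dots> = (LINT x|\<mu>. real_of_int (cyc f (g x)) + real_of_int (cyc g x))"
    by (intro Bochner_Integration.integral_cong) (simp_all add: space_mu cyc_mult f g)
  also have "\<dots> = (LINT x|\<mu>. real_of_int (cyc f (g x))) + (LINT x|\<mu>. real_of_int (cyc g x))"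
    using i cyc_integrable[OF lg] by (rule Bochner_Integration.integral_add)
  also have "(LINT x|\<mu>. real_of_int (cyc f (g x))) = (LINT x|distr \<mu> \<mu> g. real_of_int (cyc f x))"
    using integral_distr[OF mg cyc_borel[OF lf]] by simp
  also have "\<dots> = (LINT x|\<mu>. real_of_int (cyc f x))" by (simp add: distr_carrier[OF g])
  finally show ?thesis by (simp add: index_map_cyc f g)
qed


subsection \<open>Simplicity\<close>

definition kernel :: "('a \<Rightarrow> 'a) set" where
  "kernel = {g \<in> carrier G. index_map T \<phi> g = 0}"

lemma index_map_one: "index_map T \<phi> \<one>\<^bsub>G\<^esub> = 0"
  using index_map_mult[of "\<one>\<^bsub>G\<^esub>" "\<one>\<^bsub>G\<^esub>"] by simp

lemma kernel_subgroup: "subgroup kernel G"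
proof (rule full.subgroupI)
  show "kernel \<subseteq> carrier G" by (auto simp: kernel_def)
  show "kernel \<noteq> {}" using index_map_one by (auto simp: kernel_def)
next
  fix g assume g: "g \<in> kernel"
  then have "index_map T \<phi> (inv\<^bsub>G\<^esub> g) = 0"
    using index_map_mult[of "inv\<^bsub>G\<^esub> g" g] index_map_one by (simp add: kernel_def)
  then show "inv\<^bsub>G\<^esub> g \<in> kernel" using g by (simp add: kernel_def)
next
  fix g h assume "g \<in> kernel" "h \<in> kernel"
  then show "g \<otimes>\<^bsub>G\<^esub> h \<in> kernel" using index_map_mult by (simp add: kernel_def)
qed

text \<open>The index is a homomorphism into a torsion-free group, so it vanishes on 3-cycles.\<close>

lemma three_cycles_subset_kernel: "three_cycles \<subseteq> kernel"
proof
  fix h assume h3: "h \<in> three_cycles"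
  then have h: "h \<in> carrier G" using three_cycles_carrier by blast
  obtain U i j k where U: "h = lev U (cycle3 i j k)" "clopen U" "distinct [i, j, k]" "sep {i, j, k} U"
    using h3 unfolding three_cycles_def by blast
  have p: "cycle3 i j k permutes {i, j, k}" by (rule cycle3_permutes) auto
  have c: "cycle3 i j k \<circ> cycle3 i j k = cycle3 k j i"
    using U(3) by (auto simp: cycle3_def Transposition.transpose_def fun_eq_iff)
  have "h \<otimes>\<^bsub>G\<^esub> h = lev U (cycle3 k j i)"
    using lev_mult[OF U(4,2) p p] by (simp add: U(1) c)
  also have "\<dots> = inv\<^bsub>G\<^esub> h"
    unfolding U(1) using U(3) by (intro lev_cycle3_inv[OF U(4,2), symmetric]) auto
  finally have "h \<otimes>\<^bsub>G\<^esub> (h \<otimes>\<^bsub>G\<^esub> h) = \<one>\<^bsub>G\<^esub>" using h by simp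
  then have "index_map T \<phi> h + (index_map T \<phi> h + index_map T \<phi> h) = 0"
    using index_map_mult[of h "h \<otimes>\<^bsub>G\<^esub> h"] index_map_mult[of h h] index_map_one h by simp
  then show "h \<in> kernel" using h by (simp add: kernel_def)
qed

lemma commutator_group_kernel:
  "commutator_group (index_kernel_group T \<phi>) = G\<lparr>carrier := Alt\<rparr>"
proof -
  have K: "index_kernel_group T \<phi> = G\<lparr>carrier := kernel\<rparr>"
    by (simp add: index_kernel_group_def kernel_def)
  have "derived (G\<lparr>carrier := kernel\<rparr>) kernel = Alt"
    using full.derived_consistent[OF order_refl kernel_subgroup] derived_eq_Alt[OF kernel_subgroup three_cycles_subset_kernel]
    by simp
  then show ?thesis by (simp add: K commutator_group_def)
qed

lemma Alt_simple: "is_simple_group (G\<lparr>carrier := Alt\<rparr>)"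
  unfolding is_simple_group_def
proof (intro conjI allI impI)
  show "group (G\<lparr>carrier := Alt\<rparr>)"
    using Alt_subgroup full.is_group by (rule subgroup.subgroup_is_group)
  show "carrier (G\<lparr>carrier := Alt\<rparr>) \<noteq> {\<one>\<^bsub>G\<lparr>carrier := Alt\<rparr>\<^esub>}"
    using Alt_nontrivial by simp
  fix N assume N: "N \<lhd> G\<lparr>carrier := Alt\<rparr>"
  have sub: "subgroup N (G\<lparr>carrier := Alt\<rparr>)" using N by (rule normal_imp_subgroup)
  have "a \<otimes>\<^bsub>G\<^esub> n \<otimes>\<^bsub>G\<^esub> inv\<^bsub>G\<^esub> a \<in> N" if "a \<in> Alt" "n \<in> N" for a n
    using normal.inv_op_closed2[OF N, of a n] that full.m_inv_consistent[OF Alt_subgroup] by simp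
  then have "N = {\<one>\<^bsub>G\<^esub>} \<or> N = Alt"
    using normal_in_Alt[OF full.incl_subgroup[OF Alt_subgroup sub]] subgroup.subset[OF sub] by auto
  then show "N = {\<one>\<^bsub>G\<lparr>carrier := Alt\<rparr>\<^esub>} \<or> N = carrier (G\<lparr>carrier := Alt\<rparr>)" by simp
qed

end

theorem theorem4p9:
  fixes T :: "'a topology" and \<phi> :: "'a \<Rightarrow> 'a"
  assumes "cantor_minimal_system T \<phi>"
  shows "is_simple_group (commutator_group (index_kernel_group T \<phi>))"
proof -
  interpret cantor_minimal T \<phi> by unfold_locales (rule assms)
  show ?thesis unfolding commutator_group_kernel by (rule Alt_simple)
qed

end
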